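(* Let $G$ be a totally disconnected locally compact group and let $\{O_i\}_{i\in I}$ be a directed system of compactly generated open subgroups of $G$ with $\bigcup_{i\in I}O_i=G$. The following assertions are equivalent. (i) $G\in\mathcal{R}$. (ii) There is $i\in I$ such that $O_j\in\mathcal{R}$ for all $j\geq i$.
   Context: All topological groups are Hausdorff; t.d.l.c. means totally disconnected locally compact. The directed system is indexed by a directed set $I$ with $O_i\leq O_j$ whenever $i\leq j$. The normal core of a subgroup $L$ of $K$ is $\bigcap_{k\in K}kLk^{-1}$. A t.d.l.c. group $G$ is regionally expansive if some compactly generated open subgroup $O\leq G$ has a compact open subgroup $U$ whose normal core in $O$ is trivial. A locally compact group $G$ is monolithic if the intersection of all its non-trivial closed normal subgroups is non-trivial; this intersection is then the monolith $\mathrm{Mon}(G)$. A t.d.l.c. group $G$ is robustly monolithic if it is monolithic and its monolith is non-discrete, regionally expansive and topologically simple. $\mathcal{R}$ denotes the class of robustly monolithic groups. *)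

theory Defs
  imports "HOL-Analysis.Analysis" "HOL-Algebra.Generated_Groups"
begin

text \<open>
  A topological group is a group \<open>G\<close> (in the sense of HOL-Algebra) together with an abstract
  topology \<open>T\<close> whose underlying space is \<open>carrier G\<close>. Topological groups are Hausdorff by convention.
  A subgroup \<open>H\<close> is regarded as a topological group in its own right via
  \<open>G\<lparr>carrier := H\<rparr>\<close> and \<open>subtopology T H\<close>.
\<close>

locale topological_group = group G for G :: "('a, 'b) monoid_scheme" (structure) +
  fixes T :: "'a topology"
  assumes topspace_eq: "topspace T = carrier G"
    and Hausdorff: "Hausdorff_space T"
    and continuous_mult: "continuous_map (prod_topology T T) T (\<lambda>(x, y). x \<otimes> y)"
    and continuous_inv: "continuous_map T T (\<lambda>x. inv x)"

definition totally_disconnected_space :: "'a topology \<Rightarrow> bool" where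
  "totally_disconnected_space X \<longleftrightarrow> (\<forall>S. connectedin X S \<longrightarrow> (\<exists>a. S \<subseteq> {a}))"

definition tdlc_group :: "('a, 'b) monoid_scheme \<Rightarrow> 'a topology \<Rightarrow> bool" where
  "tdlc_group G T \<longleftrightarrow>
     topological_group G T \<and> totally_disconnected_space T \<and> locally_compact_space T"

definition compactly_generated :: "('a, 'b) monoid_scheme \<Rightarrow> 'a topology \<Rightarrow> bool" where
  "compactly_generated G T \<longleftrightarrow> (\<exists>K. compactin T K \<and> generate G K = carrier G)"

definition open_subgroup :: "'a set \<Rightarrow> ('a, 'b) monoid_scheme \<Rightarrow> 'a topology \<Rightarrow> bool" where
  "open_subgroup H G T \<longleftrightarrow> subgroup H G \<and> openin T H"

definition closed_normal_subgroup :: "'a set \<Rightarrow> ('a, 'b) monoid_scheme \<Rightarrow> 'a topology \<Rightarrow> bool" where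
  "closed_normal_subgroup N G T \<longleftrightarrow> N \<lhd> G \<and> closedin T N"

definition normal_core :: "('a, 'b) monoid_scheme \<Rightarrow> 'a set \<Rightarrow> 'a set" where
  "normal_core K L = (\<Inter>k\<in>carrier K. (\<lambda>x. k \<otimes>\<^bsub>K\<^esub> x \<otimes>\<^bsub>K\<^esub> inv\<^bsub>K\<^esub> k) ` L)"

definition regionally_expansive :: "('a, 'b) monoid_scheme \<Rightarrow> 'a topology \<Rightarrow> bool" where
  "regionally_expansive G T \<longleftrightarrow>
     (\<exists>H U. open_subgroup H G T \<and>
            compactly_generated (G\<lparr>carrier := H\<rparr>) (subtopology T H) \<and>
            open_subgroup U (G\<lparr>carrier := H\<rparr>) (subtopology T H) \<and>
            compactin (subtopology T H) U \<and>
            normal_core (G\<lparr>carrier := H\<rparr>) U = {\<one>\<^bsub>G\<^esub>})"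

text \<open>
  The intersection is taken inside \<open>carrier G\<close>, so that for the trivial group, which has no
  non-trivial closed normal subgroup, the empty intersection is the (trivial) group itself.
\<close>

definition monolith :: "('a, 'b) monoid_scheme \<Rightarrow> 'a topology \<Rightarrow> 'a set" where
  "monolith G T = carrier G \<inter> \<Inter>{N. closed_normal_subgroup N G T \<and> N \<noteq> {\<one>\<^bsub>G\<^esub>}}"

definition monolithic :: "('a, 'b) monoid_scheme \<Rightarrow> 'a topology \<Rightarrow> bool" where
  "monolithic G T \<longleftrightarrow> monolith G T \<noteq> {\<one>\<^bsub>G\<^esub>}"

definition topologically_simple :: "('a, 'b) monoid_scheme \<Rightarrow> 'a topology \<Rightarrow> bool" where
  "topologically_simple G T \<longleftrightarrow>
     carrier G \<noteq> {\<one>\<^bsub>G\<^esub>} \<and>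
     (\<forall>N. closed_normal_subgroup N G T \<longrightarrow> N = {\<one>\<^bsub>G\<^esub>} \<or> N = carrier G)"

definition robustly_monolithic :: "('a, 'b) monoid_scheme \<Rightarrow> 'a topology \<Rightarrow> bool" where
  "robustly_monolithic G T \<longleftrightarrow>
     tdlc_group G T \<and> monolithic G T \<and>
     (let M = monolith G T; GM = G\<lparr>carrier := M\<rparr>; TM = subtopology T M in
        TM \<noteq> discrete_topology M \<and> regionally_expansive GM TM \<and> topologically_simple GM TM)"

definition directed_set :: "'i set \<Rightarrow> ('i \<times> 'i) set \<Rightarrow> bool" where
  "directed_set I r \<longleftrightarrow>
     I \<noteq> {} \<and> preorder_on I r \<and> (\<forall>i\<in>I. \<forall>j\<in>I. \<exists>k\<in>I. (i, k) \<in> r \<and> (j, k) \<in> r)"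

end

theory Submission
  imports Defs
begin

text \<open>
  Two mechanisms carry both implications.

  \<^bold>\<open>No element acts locally trivially.\<close> Let \<open>P\<close> be robustly monolithic with monolith \<open>M\<close>. Then only
  the identity of \<open>P\<close> centralizes a neighbourhood of \<open>\<one>\<close> in \<open>M\<close>
  (\<open>robust_quasi_centralizer_monolith\<close>). The elements of \<open>M\<close> that do so form a normal subgroup, the
  quasi-centre. If it were dense, then a compactly generated open subgroup \<open>H\<close> of \<open>M\<close> with a compact
  open subgroup \<open>V\<close> of trivial core would be generated by \<open>V\<close> and finitely many quasi-central
  elements, so a neighbourhood of \<open>\<one>\<close> in \<open>V\<close> would lie in the core of \<open>V\<close>, and \<open>M\<close> would be discrete.
  As \<open>M\<close> is topologically simple, the quasi-centre is trivial. An element of \<open>P\<close> that centralizes a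
  neighbourhood then commutes with all of \<open>M\<close>, and the centralizer of \<open>M\<close> cannot contain \<open>M\<close>.

  \<^bold>\<open>Normal subgroups cannot shrink to \<open>\<one>\<close>.\<close> Write \<open>H\<close> as generated by \<open>V\<close> and a finite set \<open>S\<close>.
  The points of \<open>V\<close> that can be moved out of \<open>V\<close> by conjugating with an element of \<open>V\<close> and then with
  one of \<open>S\<close> or its inverses form a compact set \<open>Q\<close> that misses \<open>\<one>\<close>. A subgroup normalized by the
  \<open>V\<close>-conjugates of \<open>S\<close> that misses \<open>Q\<close> meets \<open>V\<close> inside the core of \<open>V\<close>, hence trivially
  (\<open>compact_set_detecting_normal_subgroups\<close>). So \<open>Q\<close> works for all large members of the directed
  system at once. If all non-trivial closed normal subgroups of a group meet \<open>Q\<close> and the group is not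
  monolithic, then by compactness two of them intersect trivially, hence commute, and yield
  \<open>a, b \<in> Q\<close> such that all conjugates of \<open>a\<close> commute with \<open>b\<close>. If this happens cofinally, a limit
  point gives such a pair for the topologically simple centreless group \<open>M\<close>, which is absurd
  (\<open>eventually_monolithic\<close>).

  \<^bold>\<open>From \<open>G\<close> to the subgroups.\<close> Let \<open>M\<close> be the monolith of \<open>G\<close>. The two mechanisms first show that
  \<open>O\<^sub>j\<close> is monolithic for all large \<open>j\<close>. Its monolith \<open>M\<^sub>j\<close> lies in \<open>M\<close> and increases with \<open>j\<close>, and
  the union of the \<open>M\<^sub>j\<close> is normal in \<open>G\<close>, hence dense in \<open>M\<close>. So the finite set \<open>S\<close> can be chosen
  inside a single \<open>M\<^sub>j\<close>, which makes \<open>M\<^sub>j\<close> regionally expansive. A second application of the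
  limit argument, now to the groups \<open>M\<^sub>j\<close>, shows that \<open>M\<^sub>j\<close> is itself monolithic for large \<open>j\<close>. The
  monolith of \<open>M\<^sub>j\<close> is normal in \<open>O\<^sub>j\<close>, so it is all of \<open>M\<^sub>j\<close>, and \<open>M\<^sub>j\<close> is topologically simple.

  \<^bold>\<open>From the subgroups to \<open>G\<close>.\<close> The closure \<open>M\<close> of the increasing union of the \<open>M\<^sub>j\<close> is the monolith
  of \<open>G\<close>. A closed normal subgroup of \<open>M\<close> that meets every \<open>M\<^sub>j\<close> trivially commutes with each of them,
  hence is trivial by the first mechanism; otherwise it contains all large \<open>M\<^sub>j\<close>, hence \<open>M\<close>. For
  regional expansiveness, a compactly generated open subgroup of one \<open>M\<^sub>j\<close> is enlarged by a small
  compact open subgroup \<open>U\<close> of \<open>M \<inter> O\<^sub>j\<close>. The core of \<open>U\<close> meets \<open>M\<^sub>j\<close> trivially, so it centralizes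
  an open subgroup of \<open>M\<^sub>j\<close> and is trivial by the first mechanism again.

  All groups involved are subgroups of \<open>G\<close>. They are treated as subsets of \<open>carrier G\<close>, and their closed
  normal subgroups, monoliths and expansiveness are expressed through the topology and the conjugation
  of \<open>G\<close>, so that subgroups of different members of the system can be compared directly.
\<close>

section \<open>Conjugation\<close>

context group
begin

definition conj_by :: "'a \<Rightarrow> 'a \<Rightarrow> 'a" where
  "conj_by g x = g \<otimes> x \<otimes> inv g"

lemma conj_by_closed [simp]: "g \<in> carrier G \<Longrightarrow> x \<in> carrier G \<Longrightarrow> conj_by g x \<in> carrier G"
  by (simp add: conj_by_def)

lemma conj_by_one [simp]: "g \<in> carrier G \<Longrightarrow> conj_by g \<one> = \<one>" "x \<in> carrier G \<Longrightarrow> conj_by \<one> x = x"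
  by (simp_all add: conj_by_def)

lemma conj_by_mult:
  assumes "g \<in> carrier G" "h \<in> carrier G" "x \<in> carrier G"
  shows "conj_by (g \<otimes> h) x = conj_by g (conj_by h x)"
  using assms by (simp add: conj_by_def inv_mult_group m_assoc)

lemma conj_by_inv [simp]:
  assumes "g \<in> carrier G" "x \<in> carrier G"
  shows "conj_by (inv g) (conj_by g x) = x" "conj_by g (conj_by (inv g) x) = x"
  using assms by (simp_all flip: conj_by_mult)

lemma conj_by_hom:
  assumes "g \<in> carrier G" "x \<in> carrier G" "y \<in> carrier G"
  shows "conj_by g (x \<otimes> y) = conj_by g x \<otimes> conj_by g y"
  using assms by (simp add: conj_by_def m_assoc inv_solve_left)

lemma inv_conj_by:
  assumes "g \<in> carrier G" "x \<in> carrier G"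
  shows "inv (conj_by g x) = conj_by g (inv x)"
  using assms by (simp add: conj_by_def m_assoc inv_mult_group)

lemma conj_by_conj_by:
  assumes "v \<in> carrier G" "s \<in> carrier G" "x \<in> carrier G"
  shows "conj_by (conj_by v s) x = conj_by v (conj_by s (conj_by (inv v) x))"
  using assms by (simp add: conj_by_def m_assoc inv_mult_group)

lemma conj_by_eq_one_iff [simp]:
  assumes "g \<in> carrier G" "x \<in> carrier G"
  shows "conj_by g x = \<one> \<longleftrightarrow> x = \<one>"
  using assms by (metis conj_by_inv(1) conj_by_one(1) inv_closed)

lemma conj_by_fixed_iff:
  assumes "g \<in> carrier G" "x \<in> carrier G"
  shows "conj_by g x = x \<longleftrightarrow> g \<otimes> x = x \<otimes> g"
  using assms by (metis conj_by_def inv_solve_right m_closed)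

lemma conj_by_mem_subgroup:
  "subgroup H G \<Longrightarrow> g \<in> H \<Longrightarrow> x \<in> H \<Longrightarrow> conj_by g x \<in> H"
  by (simp add: conj_by_def subgroup_def)

lemma subgroup_conj_by_preimage:
  assumes "subgroup H G" "g \<in> carrier G"
  shows "subgroup {x \<in> carrier G. conj_by g x \<in> H} G"
  using assms by (intro subgroupI)
    (auto simp: conj_by_hom subgroup.one_closed subgroup.m_closed subgroup.m_inv_closed
      simp flip: inv_conj_by intro!: exI[of _ \<one>])

lemma subgroup_centralizer_one:
  assumes "a \<in> carrier G"
  shows "subgroup {x \<in> carrier G. a \<otimes> x = x \<otimes> a} G"
proof (intro subgroupI)
  fix x assume "x \<in> {x \<in> carrier G. a \<otimes> x = x \<otimes> a}"
  then show "inv x \<in> {x \<in> carrier G. a \<otimes> x = x \<otimes> a}"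
    using assms by simp (metis inv_solve_left inv_solve_right m_assoc m_closed inv_closed)
next
  fix x y assume "x \<in> {x \<in> carrier G. a \<otimes> x = x \<otimes> a}" "y \<in> {x \<in> carrier G. a \<otimes> x = x \<otimes> a}"
  then show "x \<otimes> y \<in> {x \<in> carrier G. a \<otimes> x = x \<otimes> a}"
    using assms by simp (metis m_assoc)
qed (use assms in \<open>auto intro!: exI[of _ \<one>]\<close>)

lemma conj_by_commute_iff:
  assumes "g \<in> carrier G" "x \<in> carrier G" "y \<in> carrier G"
  shows "conj_by g x \<otimes> conj_by g y = conj_by g y \<otimes> conj_by g x \<longleftrightarrow> x \<otimes> y = y \<otimes> x"
  using assms by (metis conj_by_hom conj_by_inv(1) m_closed)

lemma conj_by_mult_inv_eq_one:
  assumes "g \<in> carrier G" "x \<in> carrier G"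
  shows "conj_by g x \<otimes> inv x = \<one> \<longleftrightarrow> g \<otimes> x = x \<otimes> g"
  using assms conj_by_fixed_iff by (metis conj_by_closed inv_closed inv_equality inv_inv r_inv)

text \<open>
  The commutator of \<open>g\<close> and \<open>x\<close> in two bracketings. If \<open>g\<close> and \<open>x\<close> lie in subgroups that they
  normalize mutually, one bracketing puts it in the first subgroup and the other in the second.
\<close>

lemma commutator_alt:
  assumes "g \<in> carrier G" "x \<in> carrier G"
  shows "conj_by g x \<otimes> inv x = g \<otimes> conj_by x (inv g)"
  using assms by (simp add: conj_by_def m_assoc)

text \<open>
  Both \<open>x\<close> and its inverse have to preserve \<open>R\<close>, because \<open>R\<close> may be infinite and a conjugation could
  map it to a proper subset.
\<close>

lemma conj_by_generate_invariant:
  assumes H: "X \<subseteq> carrier G" and R: "R \<subseteq> carrier G"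
    and inv: "\<And>x r. x \<in> X \<Longrightarrow> r \<in> R \<Longrightarrow> conj_by x r \<in> R \<and> conj_by (inv x) r \<in> R"
    and h: "h \<in> generate G X" and r: "r \<in> R"
  shows "conj_by h r \<in> R"
  using h r
proof (induction arbitrary: r)
  case (eng h1 h2)
  then show ?case using conj_by_mult generate_in_carrier[OF H] R by (metis subsetD)
qed (use R inv in auto)

end

section \<open>Continuity and closure in topological groups\<close>

context topological_group
begin

lemma continuous_map_mult [continuous_intros]:
  assumes "continuous_map X T f" "continuous_map X T g"
  shows "continuous_map X T (\<lambda>x. f x \<otimes> g x)"
proof -
  have "continuous_map X T ((\<lambda>(x, y). x \<otimes> y) \<circ> (\<lambda>x. (f x, g x)))"
    using assms by (intro continuous_map_compose[OF _ continuous_mult])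
      (simp add: continuous_map_pairedI)
  then show ?thesis by (simp add: o_def)
qed

lemma continuous_map_inv [continuous_intros]:
  assumes "continuous_map X T f"
  shows "continuous_map X T (\<lambda>x. inv (f x))"
  using continuous_map_compose[OF assms continuous_inv] by (simp add: o_def)

lemma continuous_map_conj_by [continuous_intros]:
  assumes "continuous_map X T f" "continuous_map X T g"
  shows "continuous_map X T (\<lambda>x. conj_by (f x) (g x))"
  unfolding conj_by_def using assms by (intro continuous_intros)

lemma continuous_map_const_carrier [continuous_intros]:
  "a \<in> carrier G \<Longrightarrow> continuous_map X T (\<lambda>x. a)"
  by (simp add: topspace_eq)

abbreviation cl :: "'a set \<Rightarrow> 'a set" where
  "cl E \<equiv> T closure_of E"

lemma openin_carrier: "openin T X \<Longrightarrow> X \<subseteq> carrier G"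
  using openin_subset topspace_eq by blast

lemma compactin_carrier: "compactin T X \<Longrightarrow> X \<subseteq> carrier G"
  using compactin_subset_topspace topspace_eq by blast

lemma openin_vimage:
  assumes "continuous_map T T f" "openin T X"
  shows "openin T {x \<in> carrier G. f x \<in> X}"
  using openin_continuous_map_preimage[OF assms] by (simp add: topspace_eq)

lemma closedin_vimage:
  assumes "continuous_map T T f" "closedin T X"
  shows "closedin T {x \<in> carrier G. f x \<in> X}"
  using closedin_continuous_map_preimage[OF assms] by (simp add: topspace_eq)

lemma closedin_equalizer:
  assumes "continuous_map T T f" "continuous_map T T g"
  shows "closedin T {x \<in> carrier G. f x = g x}"
  using closedin_continuous_maps_eq[OF Hausdorff assms] by (simp add: topspace_eq)

lemma continuous_map_id_T [continuous_intros]: "continuous_map T T (\<lambda>x. x)"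
  by (simp add: continuous_map_id[unfolded id_def])

lemma openin_subgroup_if_neighbourhood:
  assumes M: "subgroup M G" and H: "subgroup H G" "H \<subseteq> M"
    and X: "openin T X" "\<one> \<in> X" "X \<inter> M \<subseteq> H"
  shows "\<exists>Y. openin T Y \<and> H = Y \<inter> M"
proof -
  have HG: "H \<subseteq> carrier G" using H subgroup.subset by blast
  define Y where "Y = (\<Union>h\<in>H. {x \<in> carrier G. inv h \<otimes> x \<in> X})"
  have "openin T Y" unfolding Y_def using HG X
    by (intro openin_Union) (auto intro!: openin_vimage continuous_intros)
  moreover have "H = Y \<inter> M"
  proof
    show "H \<subseteq> Y \<inter> M" unfolding Y_def using HG H X by force
    show "Y \<inter> M \<subseteq> H"
    proof
      fix x assume "x \<in> Y \<inter> M"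
      then obtain h where h: "h \<in> H" "x \<in> carrier G" "inv h \<otimes> x \<in> X" "x \<in> M"
        by (auto simp: Y_def)
      then have "inv h \<otimes> x \<in> H"
        using X(3) M H by (metis IntI subsetD subgroup.m_closed subgroup.m_inv_closed)
      then have "h \<otimes> (inv h \<otimes> x) \<in> H" using h H by (simp add: subgroup.m_closed)
      then show "x \<in> H" using h HG by (metis inv_closed inv_inv inv_solve_left' m_closed subsetD)
    qed
  qed
  ultimately show ?thesis by blast
qed

lemma closedin_relatively_open_subgroup:
  assumes M: "subgroup M G" "closedin T M" and H: "subgroup H G" "H \<subseteq> M"
    and X: "openin T X" "H = X \<inter> M"
  shows "closedin T H"
proof -
  have HG: "H \<subseteq> carrier G" using H subgroup.subset by blast
  have XG: "X \<subseteq> carrier G" using X openin_carrier by blast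
  define Y where "Y = (\<Union>h\<in>M - H. {x \<in> carrier G. inv h \<otimes> x \<in> X})"
  have "openin T Y" unfolding Y_def using M X
    by (intro openin_Union) (auto intro!: openin_vimage continuous_intros dest: subgroup.mem_carrier)
  then have "closedin T (M - Y)" using M by blast
  moreover have "M - Y = H"
  proof
    show "M - Y \<subseteq> H"
    proof
      fix x assume x: "x \<in> M - Y"
      show "x \<in> H"
      proof (rule ccontr)
        assume "x \<notin> H"
        moreover have "inv x \<otimes> x \<in> X"
          using x M H X by (metis DiffD1 IntD1 l_inv subgroup.mem_carrier subgroup.one_closed)
        ultimately show False using x M subgroup.mem_carrier unfolding Y_def by fastforce
      qed
    qed
    show "H \<subseteq> M - Y"
    proof
      fix x assume x: "x \<in> H"
      have False if h: "h \<in> M" "h \<notin> H" "inv h \<otimes> x \<in> X" for h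
      proof -
        have hG: "h \<in> carrier G" "x \<in> carrier G" using h M x HG subgroup.mem_carrier by auto
        have "inv h \<otimes> x \<in> H" using h M x H X
          by (metis IntI subgroup.m_closed subgroup.m_inv_closed subsetD)
        then have "x \<otimes> inv (inv h \<otimes> x) \<in> H" using x H
          by (simp add: subgroup.m_closed subgroup.m_inv_closed)
        moreover have "x \<otimes> inv (inv h \<otimes> x) = h" using hG by (simp add: inv_mult_group flip: m_assoc)
        ultimately show False using h by simp
      qed
      then show "x \<in> M - Y" using x H unfolding Y_def by auto
    qed
  qed
  ultimately show ?thesis by simp
qed

text \<open>
  For inversion and for conjugation this transfers closure properties of a set to its closure.
\<close>

lemma closure_of_image_mem:
  assumes "continuous_map T T f" "\<And>x. x \<in> E \<Longrightarrow> f x \<in> E" "x \<in> cl E"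
  shows "f x \<in> cl E"
proof -
  have "f ` E \<subseteq> E" using assms(2) by blast
  then have "cl (f ` E) \<subseteq> cl E" by (rule closure_of_mono)
  moreover have "f x \<in> cl (f ` E)"
    using continuous_map_image_closure_subset[OF assms(1), of E] assms(3) by blast
  ultimately show ?thesis by blast
qed

lemma subgroup_closure_of:
  assumes E: "subgroup E G"
  shows "subgroup (cl E) G"
proof (rule subgroupI)
  have EG: "E \<subseteq> carrier G" using E subgroup.subset by blast
  have EC: "E \<subseteq> cl E" using EG by (simp add: closure_of_subset topspace_eq)
  show "cl E \<subseteq> carrier G" using closure_of_subset_topspace[of T E] by (simp add: topspace_eq)
  show "cl E \<noteq> {}" using EC E subgroup.one_closed by blast
  show "inv x \<in> cl E" if "x \<in> cl E" for x
    using that E by (intro closure_of_image_mem[of "\<lambda>x. inv x"])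
      (auto intro: continuous_intros simp: subgroup.m_inv_closed)
  fix x y assume xy: "x \<in> cl E" "y \<in> cl E"
  have "(x, y) \<in> prod_topology T T closure_of (E \<times> E)" using xy by (simp add: closure_of_Times)
  then have "x \<otimes> y \<in> (\<lambda>(x, y). x \<otimes> y) ` (prod_topology T T closure_of (E \<times> E))" by force
  then have "x \<otimes> y \<in> cl ((\<lambda>(x, y). x \<otimes> y) ` (E \<times> E))"
    using continuous_map_image_closure_subset[OF continuous_mult, of "E \<times> E"] by blast
  moreover have "(\<lambda>(x, y). x \<otimes> y) ` (E \<times> E) \<subseteq> E" using E by (auto simp: subgroup.m_closed)
  ultimately show "x \<otimes> y \<in> cl E" using closure_of_mono by blast
qed

section \<open>Small compact open subgroups\<close>

text \<open>
  Van Dantzig's theorem. Wilder's theorem about compact components, applied to the component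
  \<open>{\<one>}\<close>, gives a compact open neighbourhood \<open>C\<close> of \<open>\<one>\<close>. By the tube lemma \<open>C\<close> absorbs
  right multiplication by a symmetric neighbourhood \<open>Z\<close> of \<open>\<one>\<close>, hence by the group generated by \<open>Z\<close>,
  and that group is open and contained in \<open>C\<close>.
\<close>

lemma tdlc_compact_open_subgroup:
  assumes tdlc: "tdlc_group G T" and X: "openin T X" "\<one> \<in> X"
  obtains V where "subgroup V G" "openin T V" "compactin T V" "V \<subseteq> X"
proof -
  have lc: "locally_compact_space T" and td: "totally_disconnected_space T"
    using tdlc by (auto simp: tdlc_group_def)
  obtain U K where UK: "openin T U" "compactin T K" "\<one> \<in> U" "U \<subseteq> K"
    using lc unfolding locally_compact_space_def topspace_eq by blast
  have "connected_component_of_set T \<one> = {\<one>}"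
  proof -
    obtain a where "connected_component_of_set T \<one> \<subseteq> {a}"
      using td connectedin_connected_component_of unfolding totally_disconnected_space_def by metis
    moreover have "connected_component_of T \<one> \<one>"
      by (simp add: connected_component_of_refl topspace_eq)
    ultimately show ?thesis by blast
  qed
  then have comp: "{\<one>} \<in> connected_components_of T"
    unfolding connected_components_of_def by (metis imageI one_closed topspace_eq)
  have "compactin T {\<one>}" by (simp add: topspace_eq)
  then obtain C D where CD: "openin T C" "openin T D" "disjnt C D" "C \<union> D = topspace T" "{\<one>} \<subseteq> C"
      "C \<subseteq> U \<inter> X"
    using wilder_locally_compact_component_thm[OF lc Hausdorff comp, of "U \<inter> X"] X UK by auto
  have "C = topspace T - D" using CD unfolding disjnt_def by blast
  then have Ccl: "closedin T C" using CD by blast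
  have CG: "C \<subseteq> carrier G" using CD openin_carrier by blast
  have Cco: "compactin T C" using UK CD Ccl by (meson closed_compactin le_inf_iff order_trans)
  let ?W = "{p \<in> topspace (prod_topology T T). (\<lambda>(x, y). x \<otimes> y) p \<in> C}"
  have "openin (prod_topology T T) ?W"
    using openin_continuous_map_preimage[OF continuous_mult CD(1)] .
  moreover have "C \<times> {\<one>} \<subseteq> ?W" using CG by (auto simp: topspace_eq)
  ultimately obtain A Y where AY: "openin T A" "openin T Y" "C \<subseteq> A" "\<one> \<in> Y" "A \<times> Y \<subseteq> ?W"
    using tube_lemma_left[OF _ Cco, of T ?W \<one>] by (auto simp: topspace_eq)
  define Z where "Z = Y \<inter> {x \<in> carrier G. inv x \<in> Y}"
  have Z: "openin T Z" "\<one> \<in> Z" "Z \<subseteq> carrier G" unfolding Z_def using AY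
    by (auto intro!: openin_Int openin_vimage continuous_intros)
  have CZ: "c \<otimes> z \<in> C" "c \<otimes> inv z \<in> C" if "c \<in> C" "z \<in> Z" for c z
  proof -
    have "(c, z) \<in> ?W" "(c, inv z) \<in> ?W" using AY that unfolding Z_def by blast+
    then show "c \<otimes> z \<in> C" "c \<otimes> inv z \<in> C" by auto
  qed
  have *: "c \<otimes> h \<in> C" if "h \<in> generate G Z" "c \<in> C" for h c
    using that
  proof (induction arbitrary: c)
    case (eng h1 h2)
    then have "c \<otimes> h1 \<otimes> h2 \<in> C" by blast
    then show ?case using eng generate_in_carrier[OF Z(3)] CG by (simp add: m_assoc subsetD)
  qed (use CG CZ in auto)
  let ?V = "generate G Z"
  have V: "subgroup ?V G" using Z generate_is_subgroup by blast
  have VC: "?V \<subseteq> C"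
  proof
    fix h assume h: "h \<in> ?V"
    have "\<one> \<otimes> h \<in> C" using * h CD by blast
    then show "h \<in> C" using generate_in_carrier[OF Z(3) h] by simp
  qed
  have "\<exists>Y. openin T Y \<and> ?V = Y \<inter> carrier G"
    using V Z by (intro openin_subgroup_if_neighbourhood[of _ _ Z])
      (auto intro: generate.incl subgroup_self dest: subgroup.mem_carrier)
  then have Vo: "openin T ?V" using openin_Int openin_topspace[of T] by (auto simp: topspace_eq)
  then have "closedin T ?V"
    using V subgroup_self closedin_topspace[of T]
    by (intro closedin_relatively_open_subgroup[of "carrier G" ?V ?V])
      (auto simp: topspace_eq dest: subgroup.mem_carrier)
  then have "compactin T ?V" using Cco VC closed_compactin by blast
  then show ?thesis using that V Vo VC CD by blast
qed

lemma closedin_open_subgroup: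
  assumes "subgroup P G" "openin T P"
  shows "closedin T P"
proof (rule closedin_relatively_open_subgroup[OF subgroup_self])
  show "closedin T (carrier G)" using closedin_topspace[of T] by (simp add: topspace_eq)
  show "P \<subseteq> carrier G" using assms subgroup.subset by blast
  then show "P = P \<inter> carrier G" by blast
qed (use assms in simp_all)

section \<open>Robust monolithicity inside an ambient group\<close>

text \<open>
  The notions below describe a subgroup \<open>P\<close> by subsets of \<open>G\<close>. They agree with those for the
  topological group \<open>P\<close> when \<open>P\<close> is closed in \<open>G\<close>; this is why \<open>N\<close> is asked to be closed in \<open>G\<close>
  rather than in \<open>P\<close>.
\<close>

definition closed_normal_in :: "'a set \<Rightarrow> 'a set \<Rightarrow> bool" where
  "closed_normal_in P N \<longleftrightarrow>
     subgroup N G \<and> N \<subseteq> P \<and> closedin T N \<and> (\<forall>p\<in>P. \<forall>n\<in>N. conj_by p n \<in> N)"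

definition monolith_in :: "'a set \<Rightarrow> 'a set" where
  "monolith_in P = P \<inter> \<Inter>{N. closed_normal_in P N \<and> N \<noteq> {\<one>}}"

definition nondiscrete :: "'a set \<Rightarrow> bool" where
  "nondiscrete M \<longleftrightarrow> (\<forall>X. openin T X \<longrightarrow> \<one> \<in> X \<longrightarrow> X \<inter> M \<noteq> {\<one>})"

definition open_subgroup_in :: "'a set \<Rightarrow> 'a set \<Rightarrow> bool" where
  "open_subgroup_in M H \<longleftrightarrow> subgroup H G \<and> (\<exists>X. openin T X \<and> H = X \<inter> M)"

text \<open>
  The pairs that witness that \<open>M\<close> is regionally expansive. The last conjunct is the triviality of the
  normal core of \<open>V\<close> in \<open>H\<close>, and openness of \<open>V\<close> in \<open>M\<close> is equivalent to openness in the open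
  subgroup \<open>H\<close>.
\<close>

definition expansive_pair :: "'a set \<Rightarrow> 'a set \<Rightarrow> 'a set \<Rightarrow> bool" where
  "expansive_pair M H V \<longleftrightarrow>
     open_subgroup_in M H \<and> (\<exists>K. compactin T K \<and> generate G K = H) \<and>
     open_subgroup_in M V \<and> V \<subseteq> H \<and> compactin T V \<and>
     (\<forall>x\<in>carrier G. (\<forall>h\<in>H. conj_by h x \<in> V) \<longrightarrow> x = \<one>)"

definition simple_in :: "'a set \<Rightarrow> bool" where
  "simple_in M \<longleftrightarrow> M \<noteq> {\<one>} \<and> (\<forall>N. closed_normal_in M N \<longrightarrow> N = {\<one>} \<or> N = M)"

definition robust :: "'a set \<Rightarrow> bool" where
  "robust P \<longleftrightarrow> monolith_in P \<noteq> {\<one>} \<and> nondiscrete (monolith_in P) \<and>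
     (\<exists>H V. expansive_pair (monolith_in P) H V) \<and> simple_in (monolith_in P)"

lemma subgroup_subgroup_iff:
  assumes "subgroup P G"
  shows "subgroup N (G\<lparr>carrier := P\<rparr>) \<longleftrightarrow> subgroup N G \<and> N \<subseteq> P"
proof
  assume N: "subgroup N (G\<lparr>carrier := P\<rparr>)"
  then have "N \<subseteq> P" using subgroup.subset[OF N] by simp
  with N show "subgroup N G \<and> N \<subseteq> P" using incl_subgroup[OF assms] by blast
next
  assume "subgroup N G \<and> N \<subseteq> P"
  then show "subgroup N (G\<lparr>carrier := P\<rparr>)" using subgroup_incl assms by blast
qed

lemma closed_normal_subgroup_iff:
  assumes P: "subgroup P G" "closedin T P"
  shows "closed_normal_subgroup N (G\<lparr>carrier := P\<rparr>) (subtopology T P) \<longleftrightarrow> closed_normal_in P N"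
proof -
  interpret GP: group "G\<lparr>carrier := P\<rparr>" using P subgroup_imp_group by blast
  show ?thesis
    unfolding closed_normal_subgroup_def closed_normal_in_def GP.normal_inv_iff
    using P by (auto simp: subgroup_subgroup_iff closedin_closed_subtopology conj_by_def)
qed

lemma monolith_eq_monolith_in:
  assumes "subgroup P G" "closedin T P"
  shows "monolith (G\<lparr>carrier := P\<rparr>) (subtopology T P) = monolith_in P"
  by (simp add: monolith_def monolith_in_def closed_normal_subgroup_iff assms)

lemma normal_core_eq_one_iff:
  assumes H: "subgroup H G" and V: "subgroup V G" "V \<subseteq> H"
  shows "normal_core (G\<lparr>carrier := H\<rparr>) V = {\<one>} \<longleftrightarrow>
    (\<forall>x\<in>carrier G. (\<forall>h\<in>H. conj_by h x \<in> V) \<longrightarrow> x = \<one>)"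
proof -
  have HG: "H \<subseteq> carrier G" "V \<subseteq> carrier G" using H V subgroup.subset by auto
  have "normal_core (G\<lparr>carrier := H\<rparr>) V = (\<Inter>k\<in>H. conj_by k ` V)"
    using H by (simp add: normal_core_def conj_by_def)
  also have "\<dots> = {x \<in> carrier G. \<forall>h\<in>H. conj_by h x \<in> V}"
  proof (intro equalityI subsetI)
    fix x assume x: "x \<in> (\<Inter>k\<in>H. conj_by k ` V)"
    have "conj_by h x \<in> V" if h: "h \<in> H" for h
    proof -
      obtain v where "v \<in> V" "x = conj_by (inv h) v"
        using x h H subgroup.m_inv_closed by fastforce
      moreover have "v \<in> carrier G" "h \<in> carrier G" using HG h \<open>v \<in> V\<close> by auto
      ultimately show ?thesis by simp
    qed
    moreover have "x \<in> conj_by \<one> ` V" using x H subgroup.one_closed by blast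
    then have "x \<in> carrier G" using HG by auto
    ultimately show "x \<in> {x \<in> carrier G. \<forall>h\<in>H. conj_by h x \<in> V}" by blast
  next
    fix x assume x: "x \<in> {x \<in> carrier G. \<forall>h\<in>H. conj_by h x \<in> V}"
    show "x \<in> (\<Inter>k\<in>H. conj_by k ` V)"
    proof
      fix k assume k: "k \<in> H"
      then have "x = conj_by k (conj_by (inv k) x)" using x HG by auto
      moreover have "conj_by (inv k) x \<in> V" using x k H subgroup.m_inv_closed by fastforce
      ultimately show "x \<in> conj_by k ` V" by blast
    qed
  qed
  finally have eq: "normal_core (G\<lparr>carrier := H\<rparr>) V = {x \<in> carrier G. \<forall>h\<in>H. conj_by h x \<in> V}" .
  have "\<one> \<in> {x \<in> carrier G. \<forall>h\<in>H. conj_by h x \<in> V}"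
    using HG subgroup.one_closed[OF V(1)] by (auto simp: subset_iff)
  then show ?thesis unfolding eq by blast
qed

lemma regionally_expansive_iff:
  assumes M: "subgroup M G"
  shows "regionally_expansive (G\<lparr>carrier := M\<rparr>) (subtopology T M) \<longleftrightarrow> (\<exists>H V. expansive_pair M H V)"
proof -
  have "(open_subgroup H (G\<lparr>carrier := M\<rparr>) (subtopology T M) \<and>
      compactly_generated (G\<lparr>carrier := M, carrier := H\<rparr>) (subtopology (subtopology T M) H) \<and>
      open_subgroup V (G\<lparr>carrier := M, carrier := H\<rparr>) (subtopology (subtopology T M) H) \<and>
      compactin (subtopology (subtopology T M) H) V \<and>
      normal_core (G\<lparr>carrier := M, carrier := H\<rparr>) V = {\<one>}) \<longleftrightarrow> expansive_pair M H V"
    (is "?L \<longleftrightarrow> ?R") for H V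
  proof (cases "subgroup H G \<and> H \<subseteq> M \<and> subgroup V G \<and> V \<subseteq> H")
    case True
    then have H: "subgroup H G" "H \<subseteq> M" and V: "subgroup V G" "V \<subseteq> H" by auto
    have T: "subtopology (subtopology T M) H = subtopology T H"
      using H by (simp add: subtopology_subtopology inf.absorb2)
    have 1: "compactly_generated (G\<lparr>carrier := H\<rparr>) (subtopology T H) \<longleftrightarrow>
        (\<exists>K. compactin T K \<and> generate G K = H)"
    proof -
      have "(K \<subseteq> H \<and> generate (G\<lparr>carrier := H\<rparr>) K = H) \<longleftrightarrow> generate G K = H" for K
        using generate_consistent[OF _ H(1), of K] generate.incl[of _ K G] by blast
      then show ?thesis unfolding compactly_generated_def compactin_subtopology by simp
    qed
    have 2: "openin (subtopology T H) V \<longleftrightarrow> openin (subtopology T M) V"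
      if "openin (subtopology T M) H"
      using openin_open_subtopology[OF that, of V] V T by simp
    have 3: "openin (subtopology T M) H \<longleftrightarrow> (\<exists>X. openin T X \<and> H = X \<inter> M)"
      "openin (subtopology T M) V \<longleftrightarrow> (\<exists>X. openin T X \<and> V = X \<inter> M)"
      by (simp_all add: openin_subtopology)
    have 4: "(G\<lparr>carrier := M, carrier := H\<rparr>) = G\<lparr>carrier := H\<rparr>" by simp
    show ?thesis
      unfolding open_subgroup_def expansive_pair_def open_subgroup_in_def 4 T 1 compactin_subtopology
        subgroup_subgroup_iff[OF M] subgroup_subgroup_iff[OF H(1)] normal_core_eq_one_iff[OF H(1) V]
      using H V 2 3 by blast
  next
    case False
    have 4: "(G\<lparr>carrier := M, carrier := H\<rparr>) = G\<lparr>carrier := H\<rparr>" by simp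
    have "\<not> ?R" using False unfolding expansive_pair_def open_subgroup_in_def by blast
    moreover have "\<not> ?L" using False unfolding open_subgroup_def 4
      using M subgroup_subgroup_iff by blast
    ultimately show ?thesis by blast
  qed
  then show ?thesis unfolding regionally_expansive_def by simp
qed

lemma subgroup_monolith_in: 
  assumes "subgroup P G"
  shows "subgroup (monolith_in P) G"
proof -
  have "monolith_in P = \<Inter>(insert P {N. closed_normal_in P N \<and> N \<noteq> {\<one>}})" by (simp add: monolith_in_def)
  then show ?thesis using assms subgroups_Inter[of "insert P {N. closed_normal_in P N \<and> N \<noteq> {\<one>}}"]
    by (auto simp: closed_normal_in_def)
qed

lemma closed_normal_monolith_in:
  assumes P: "subgroup P G" "closedin T P"
  shows "closed_normal_in P (monolith_in P)"
proof -
  have "monolith_in P = \<Inter>(insert P {N. closed_normal_in P N \<and> N \<noteq> {\<one>}})" by (simp add: monolith_in_def)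
  then have "closedin T (monolith_in P)"
    using P closedin_Inter[of "insert P {N. closed_normal_in P N \<and> N \<noteq> {\<one>}}" T]
    unfolding closed_normal_in_def by (metis (no_types, lifting) insert_iff insert_not_empty mem_Collect_eq)
  moreover have "conj_by p n \<in> monolith_in P" if "p \<in> P" "n \<in> monolith_in P" for p n
  proof -
    have "conj_by p n \<in> P" using that P conj_by_mem_subgroup by (simp add: monolith_in_def)
    moreover have "conj_by p n \<in> N" if "closed_normal_in P N" "N \<noteq> {\<one>}" for N
      using that \<open>p \<in> P\<close> \<open>n \<in> monolith_in P\<close> by (simp add: monolith_in_def closed_normal_in_def)
    ultimately show ?thesis by (simp add: monolith_in_def)
  qed
  moreover have "monolith_in P \<subseteq> P" by (simp add: monolith_in_def)
  ultimately show ?thesis using subgroup_monolith_in[OF P(1)] by (simp add: closed_normal_in_def)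
qed

lemma monolith_in_subset: "monolith_in P \<subseteq> P" by (auto simp: monolith_in_def)

lemma monolith_in_minimal: "closed_normal_in P N \<Longrightarrow> N \<noteq> {\<one>} \<Longrightarrow> monolith_in P \<subseteq> N"
  by (auto simp: monolith_in_def)

lemma closedin_monolith_in: "subgroup P G \<Longrightarrow> closedin T P \<Longrightarrow> closedin T (monolith_in P)"
  by (simp add: closed_normal_monolith_in[unfolded closed_normal_in_def])

lemma nondiscrete_iff:
  assumes M: "subgroup M G"
  shows "subtopology T M \<noteq> discrete_topology M \<longleftrightarrow> nondiscrete M"
proof -
  have MG: "M \<subseteq> carrier G" using M subgroup.subset by blast
  have "subtopology T M = discrete_topology M \<longleftrightarrow> (\<exists>X. openin T X \<and> \<one> \<in> X \<and> X \<inter> M = {\<one>})" (is "?L \<longleftrightarrow> ?R")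
  proof
    assume ?L
    then have "openin (subtopology T M) {\<one>}" using M by (simp add: subgroup.one_closed)
    then show ?R by (auto simp: openin_subtopology)
  next
    assume ?R
    then obtain X where X: "openin T X" "\<one> \<in> X" "X \<inter> M = {\<one>}" by blast
    have "openin (subtopology T M) {m}" if m: "m \<in> M" for m
    proof -
      have "{m} = {x \<in> carrier G. inv m \<otimes> x \<in> X} \<inter> M" (is "_ = ?Y \<inter> M")
      proof
        show "{m} \<subseteq> ?Y \<inter> M" using m MG X by auto
        show "?Y \<inter> M \<subseteq> {m}"
        proof
          fix x assume x: "x \<in> ?Y \<inter> M"
          then have "inv m \<otimes> x \<in> X \<inter> M" using m M by (simp add: subgroup.m_closed subgroup.m_inv_closed)
          then have "inv m \<otimes> x = \<one>" using X by blast
          moreover have "m \<otimes> (inv m \<otimes> x) = x" using x m MG by (simp add: subset_iff flip: m_assoc)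
          ultimately show "x \<in> {m}" using m MG by auto
        qed
      qed
      moreover have "openin T ?Y" using m MG X by (intro openin_vimage continuous_intros) auto
      ultimately show ?thesis by (metis openin_subtopology_Int)
    qed
    then show ?L using MG by (simp add: discrete_topology_unique topspace_eq Int_absorb1 eq_commute)
  qed
  then show ?thesis unfolding nondiscrete_def by blast
qed

lemma topological_group_subgroup:
  assumes P: "subgroup P G"
  shows "topological_group (G\<lparr>carrier := P\<rparr>) (subtopology T P)"
proof -
  have PG: "P \<subseteq> carrier G" using P subgroup.subset by blast
  interpret GP: group "G\<lparr>carrier := P\<rparr>" using P subgroup_imp_group by blast
  show ?thesis
  proof
    show "topspace (subtopology T P) = carrier (G\<lparr>carrier := P\<rparr>)"
      using PG by (auto simp: topspace_eq)
    show "Hausdorff_space (subtopology T P)" using Hausdorff by (simp add: Hausdorff_space_subtopology)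
    have "continuous_map (subtopology (prod_topology T T) (P \<times> P)) T (\<lambda>(x, y). x \<otimes> y)"
      using continuous_mult continuous_map_from_subtopology by blast
    then show "continuous_map (prod_topology (subtopology T P) (subtopology T P)) (subtopology T P)
        (\<lambda>(x, y). x \<otimes>\<^bsub>G\<lparr>carrier := P\<rparr>\<^esub> y)"
      using P by (auto simp: continuous_map_in_subtopology subtopology_Times[symmetric] subgroup.m_closed)
    have "continuous_map (subtopology T P) (subtopology T P) (\<lambda>x. inv x)"
      using continuous_inv P by (auto simp: continuous_map_in_subtopology continuous_map_from_subtopology
          subgroup.m_inv_closed)
    then show "continuous_map (subtopology T P) (subtopology T P) (\<lambda>x. inv\<^bsub>G\<lparr>carrier := P\<rparr>\<^esub> x)"
      by (rule continuous_map_eq) (use P in auto)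
  qed
qed

lemma tdlc_group_subgroup:
  assumes "tdlc_group G T" and P: "subgroup P G" "closedin T P"
  shows "tdlc_group (G\<lparr>carrier := P\<rparr>) (subtopology T P)"
proof -
  have "locally_compact_space (subtopology T P)"
    using assms locally_compact_space_closed_subset unfolding tdlc_group_def by blast
  moreover have "totally_disconnected_space (subtopology T P)"
    using assms unfolding tdlc_group_def totally_disconnected_space_def connectedin_subtopology by blast
  ultimately show ?thesis using topological_group_subgroup[OF P(1)] unfolding tdlc_group_def by blast
qed

lemma robustly_monolithic_iff:
  assumes G: "tdlc_group G T" and P: "subgroup P G" "closedin T P"
  shows "robustly_monolithic (G\<lparr>carrier := P\<rparr>) (subtopology T P) \<longleftrightarrow> robust P"
proof -
  let ?M = "monolith_in P"
  have M: "subgroup ?M G" "closedin T ?M" "?M \<subseteq> P"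
    using P subgroup_monolith_in closedin_monolith_in monolith_in_subset by auto
  have T: "subtopology (subtopology T P) ?M = subtopology T ?M"
    using M by (simp add: subtopology_subtopology inf.absorb2)
  show ?thesis
    unfolding robustly_monolithic_def robust_def monolithic_def Let_def monolith_eq_monolith_in[OF P] T
      topologically_simple_def simple_in_def
    using tdlc_group_subgroup[OF G P] M
    by (simp add: regionally_expansive_iff nondiscrete_iff closed_normal_subgroup_iff)
qed

section \<open>Expansive pairs\<close>

lemma closure_meets_open:
  assumes "x \<in> cl D" "openin T W" "x \<in> W"
  obtains d where "d \<in> D" "d \<in> W"
  using assms unfolding in_closure_of by blast

lemma open_subgroup_inD:
  assumes "open_subgroup_in M H"
  shows "subgroup H G" "H \<subseteq> M" "H \<subseteq> carrier G"
proof -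
  show "subgroup H G" using assms by (simp add: open_subgroup_in_def)
  then show "H \<subseteq> carrier G" by (rule subgroup.subset)
  show "H \<subseteq> M" using assms by (auto simp: open_subgroup_in_def)
qed

lemma expansive_pairD:
  assumes "expansive_pair M H V"
  shows "open_subgroup_in M H" "open_subgroup_in M V" "V \<subseteq> H" "compactin T V" "\<exists>K. compactin T K \<and> generate G K = H"
  using assms by (auto simp: expansive_pair_def)

lemma expansive_pair_core:
  assumes "expansive_pair M H V" "x \<in> carrier G" "\<And>h. h \<in> H \<Longrightarrow> conj_by h x \<in> V"
  shows "x = \<one>"
  using assms by (auto simp: expansive_pair_def)

text \<open>
  The cosets \<open>d V\<close> with \<open>d \<in> D\<close> are open in \<open>H\<close> and cover it, since \<open>D\<close> is dense. Finitely many of them cover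
  a compact generating set. The freedom to choose the generators in a dense subset is what lets them be
  quasi-central in one application and lie in a single monolith of the directed system in another.
\<close>

lemma finite_generation_over_open_subgroup:
  assumes pair: "expansive_pair M H V" and D: "D \<subseteq> H" "H \<subseteq> cl D"
  obtains S where "finite S" "S \<subseteq> D" "generate G (S \<union> V) = H"
proof -
  note p = expansive_pairD[OF pair]
  note H = open_subgroup_inD[OF p(1)] and V = open_subgroup_inD[OF p(2)]
  obtain K where K: "compactin T K" "generate G K = H" using p(5) by blast
  obtain X where X: "openin T X" "V = X \<inter> M" using p(2) by (auto simp: open_subgroup_in_def)
  have KH: "K \<subseteq> H" using K generate.incl[of _ K G] by blast
  let ?O = "\<lambda>d. {x \<in> carrier G. inv d \<otimes> x \<in> X}"
  have O: "openin T (?O d)" if "d \<in> D" for d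
    using that D H X by (intro openin_vimage continuous_intros) auto
  have "H \<subseteq> (\<Union>d\<in>D. ?O d)"
  proof
    fix h assume h: "h \<in> H"
    let ?W = "{x \<in> carrier G. inv x \<otimes> h \<in> X}"
    have "openin T ?W" using h H X by (intro openin_vimage continuous_intros) auto
    moreover have "h \<in> ?W"
    proof -
      have "h \<in> carrier G" using h H by blast
      moreover have "\<one> \<in> X" using subgroup.one_closed[OF V(1)] X by blast
      ultimately show ?thesis by simp
    qed
    moreover have "h \<in> cl D" using h D by blast
    ultimately obtain d where "d \<in> D" "d \<in> ?W" by (rule_tac closure_meets_open[of h D ?W])
    then show "h \<in> (\<Union>d\<in>D. ?O d)" using h H by auto
  qed
  then have "K \<subseteq> \<Union>(?O ` D)" using KH by blast
  then obtain F where F: "finite F" "F \<subseteq> ?O ` D" "K \<subseteq> \<Union>F"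
    using compactinD[OF K(1), of "?O ` D"] O by blast
  then obtain S where S: "finite S" "S \<subseteq> D" "F = ?O ` S" by (meson finite_subset_image)
  have "S \<union> V \<subseteq> H" using S D p(3) by blast
  then have 1: "generate G (S \<union> V) \<subseteq> H" using generate_subgroup_incl H(1) by blast
  have sub: "subgroup (generate G (S \<union> V)) G" using \<open>S \<union> V \<subseteq> H\<close> H by (intro generate_is_subgroup) auto
  have "K \<subseteq> generate G (S \<union> V)"
  proof
    fix k assume k: "k \<in> K"
    then obtain s where s: "s \<in> S" "inv s \<otimes> k \<in> X" using F S by blast
    have sH: "s \<in> H" using s S D by blast
    have kH: "k \<in> H" using k KH by blast
    have "inv s \<otimes> k \<in> H" using sH kH H(1) by (simp add: subgroup.m_closed subgroup.m_inv_closed)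
    then have "inv s \<otimes> k \<in> V" using s X H by blast
    then have "s \<otimes> (inv s \<otimes> k) \<in> generate G (S \<union> V)"
      using s by (intro generate.eng[OF generate.incl generate.incl]) auto
    moreover have "s \<otimes> (inv s \<otimes> k) = k"
    proof -
      have "s \<in> carrier G" "k \<in> carrier G" using sH kH H by auto
      then show ?thesis by (simp flip: m_assoc)
    qed
    ultimately show "k \<in> generate G (S \<union> V)" by simp
  qed
  then have "H \<subseteq> generate G (S \<union> V)" using generate_subgroup_incl[OF _ sub] K by blast
  with 1 show ?thesis using that S by blast
qed

text \<open>
  The \<open>V\<close>-conjugates of \<open>C\<close> form a set \<open>R \<subseteq> V\<close> that \<open>V\<close> and \<open>S\<close> preserve, so \<open>R\<close> lies in the core of
  \<open>V\<close>. Invariance of \<open>C\<close> is demanded only under the \<open>V\<close>-conjugates of \<open>S\<close>, not under \<open>V\<close>, so that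
  the lemma applies to traces on \<open>V\<close> of subgroups that \<open>V\<close> does not normalize.
\<close>

lemma invariant_subset_trivial:
  assumes pair: "expansive_pair M H V" and S: "generate G (S \<union> V) = H" and C: "C \<subseteq> V"
    and inv: "\<And>v s c. v \<in> V \<Longrightarrow> s \<in> S \<Longrightarrow> c \<in> C \<Longrightarrow>
      conj_by (conj_by v s) c \<in> C \<and> conj_by (conj_by v (inv s)) c \<in> C"
  shows "C \<subseteq> {\<one>}"
proof
  fix c assume c: "c \<in> C"
  note p = expansive_pairD[OF pair]
  note H = open_subgroup_inD[OF p(1)] and V = open_subgroup_inD[OF p(2)]
  have SG: "S \<subseteq> carrier G" using S H generate.incl[of _ "S \<union> V" G] by blast
  define R where "R = (\<lambda>(v, c). conj_by v c) ` (V \<times> C)"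
  have RV: "R \<subseteq> V" unfolding R_def using V(1) C conj_by_mem_subgroup by auto
  have R: "conj_by v c \<in> R" if "v \<in> V" "c \<in> C" for v c using that unfolding R_def by force
  have "conj_by h c \<in> R" if h: "h \<in> H" for h
  proof (rule conj_by_generate_invariant[of "S \<union> V" R])
    show "S \<union> V \<subseteq> carrier G" using SG V by blast
    show "R \<subseteq> carrier G" using RV V by blast
    show "h \<in> generate G (S \<union> V)" using h S by simp
    have "conj_by \<one> c \<in> R" using R c V(1) subgroup.one_closed by blast
    then show "c \<in> R" using c C V by auto
    fix x r assume x: "x \<in> S \<union> V" and "r \<in> R"
    then obtain v d where r: "r = conj_by v d" "v \<in> V" "d \<in> C" unfolding R_def by auto
    have vd: "v \<in> carrier G" "d \<in> carrier G" using r C V by auto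
    have iv: "inv v \<in> V" using r V(1) by (simp add: subgroup.m_inv_closed)
    show "conj_by x r \<in> R \<and> conj_by (inv x) r \<in> R"
    proof (cases "x \<in> V")
      case True
      then have "x \<otimes> v \<in> V" "inv x \<otimes> v \<in> V"
        using r V(1) by (simp_all add: subgroup.m_closed subgroup.m_inv_closed)
      moreover have "x \<in> carrier G" using True V by blast
      ultimately show ?thesis using R[of _ d] r vd by (simp flip: conj_by_mult)
    next
      case False
      then have x: "x \<in> S" "x \<in> carrier G" using x SG by auto
      have *: "conj_by y r = conj_by v (conj_by (conj_by (inv v) y) d)" if "y \<in> carrier G" for y
        using vd that r by (simp add: conj_by_conj_by)
      show ?thesis using *[of x] *[of "inv x"] inv[OF iv x(1) r(3)] R[OF r(2)] x by simp
    qed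
  qed
  then have "conj_by h c \<in> V" if "h \<in> H" for h using RV that by blast
  then show "c \<in> {\<one>}" using expansive_pair_core[OF pair, of c] c C V by blast
qed

text \<open>
  The set is the image of a compact subset of \<open>A \<times> B\<close> under the projection to \<open>B\<close>. With \<open>A\<close> an open compact subgroup acting by conjugation,
  this handles the points some conjugate of which leaves a given open set.
\<close>

lemma compactin_projection:
  assumes A: "compactin T A" and B: "compactin T B" and Z: "closedin T Z"
    and f: "continuous_map (prod_topology T T) T (\<lambda>p. f (fst p) (snd p))"
  shows "compactin T {b \<in> B. \<exists>a\<in>A. f a b \<in> Z}"
proof -
  let ?E = "{p \<in> topspace (prod_topology T T). f (fst p) (snd p) \<in> Z}"
  have "closedin (prod_topology T T) ?E" using closedin_continuous_map_preimage[OF f Z] .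
  then have "compactin (prod_topology T T) (?E \<inter> A \<times> B)"
    using A B by (intro closed_Int_compactin) (simp add: compactin_Times)+
  then have "compactin T (snd ` (?E \<inter> A \<times> B))"
    using image_compactin continuous_map_snd by blast
  moreover have "snd ` (?E \<inter> A \<times> B) = {b \<in> B. \<exists>a\<in>A. f a b \<in> Z}"
  proof -
    have AB: "A \<subseteq> topspace T" "B \<subseteq> topspace T" using A B compactin_subset_topspace by auto
    show ?thesis
    proof (intro equalityI subsetI)
      fix b assume "b \<in> {b \<in> B. \<exists>a\<in>A. f a b \<in> Z}"
      then obtain a where "a \<in> A" "b \<in> B" "f a b \<in> Z" by blast
      then have "(a, b) \<in> ?E \<inter> A \<times> B" using AB by auto
      then show "b \<in> snd ` (?E \<inter> A \<times> B)" by (rule image_eqI[rotated]) simp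
    qed auto
  qed
  ultimately show ?thesis by simp
qed

text \<open>
  \<open>Q\<close> depends on \<open>V\<close> and \<open>S\<close> only, and neither on \<open>N\<close> nor on the group \<open>P\<close> normalizing \<open>N\<close>: this
  uniformity is what allows limits over the directed system. In one application \<open>P\<close>
  is an open subgroup of \<open>G\<close>, in another it is the monolith of such a subgroup, which may miss parts of \<open>V\<close>.
\<close>

lemma compact_set_detecting_normal_subgroups:
  assumes pair: "expansive_pair M H V" and S: "finite S" "generate G (S \<union> V) = H"
  obtains Q where "compactin T Q" "Q \<subseteq> V" "\<one> \<notin> Q"
    "\<And>N P. subgroup N G \<Longrightarrow> subgroup P G \<Longrightarrow> (\<And>v s. v \<in> V \<Longrightarrow> s \<in> S \<Longrightarrow> conj_by v s \<in> P) \<Longrightarrow>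
       (\<And>p n. p \<in> P \<Longrightarrow> n \<in> N \<Longrightarrow> conj_by p n \<in> N) \<Longrightarrow> N \<inter> Q = {} \<Longrightarrow> N \<inter> V \<subseteq> {\<one>}"
proof -
  note p = expansive_pairD[OF pair]
  note H = open_subgroup_inD[OF p(1)] and V = open_subgroup_inD[OF p(2)]
  obtain X where X: "openin T X" "V = X \<inter> M" using p(2) by (auto simp: open_subgroup_in_def)
  have SH: "S \<subseteq> H" using S generate.incl[of _ "S \<union> V" G] by blast
  \<comment> \<open>\<open>V\<close> is open in \<open>M\<close> only, so leaving \<open>V\<close> is not a closed condition in \<open>G\<close>. Leaving \<open>X\<close> is one, and
    it amounts to the same because the conjugations below stay inside \<open>M\<close>.\<close>
  define S' where "S' = S \<union> m_inv G ` S"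
  have S': "finite S'" "S' \<subseteq> H" "S' \<subseteq> carrier G"
    unfolding S'_def using S SH H subgroup.m_inv_closed[OF H(1)] by (auto simp: subset_iff)
  define Q where "Q = (\<Union>s\<in>S'. {w \<in> V. \<exists>v\<in>V. conj_by s (conj_by v w) \<in> carrier G - X})"
  have cl: "closedin T (carrier G - X)" using X by (metis closedin_topspace closedin_diff topspace_eq)
  have "compactin T Q" unfolding Q_def
  proof (intro compactin_Union)
    fix A assume "A \<in> (\<lambda>s. {w \<in> V. \<exists>v\<in>V. conj_by s (conj_by v w) \<in> carrier G - X}) ` S'"
    then obtain s where s: "s \<in> carrier G"
      "A = {w \<in> V. \<exists>v\<in>V. conj_by s (conj_by v w) \<in> carrier G - X}" using S' by blast
    show "compactin T A" unfolding s(2)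
      using s p by (intro compactin_projection cl continuous_intros continuous_map_fst continuous_map_snd)
  qed (use S' in simp)
  moreover have "Q \<subseteq> V" unfolding Q_def by blast
  moreover have "\<one> \<notin> Q"
  proof -
    have "\<one> \<in> X" using subgroup.one_closed[OF V(1)] X by blast
    moreover have "conj_by s (conj_by v \<one>) = \<one>" if "s \<in> S'" "v \<in> V" for s v
    proof -
      have "s \<in> carrier G" "v \<in> carrier G" using that S' V by auto
      then show ?thesis by simp
    qed
    ultimately show ?thesis unfolding Q_def by auto
  qed
  moreover have "N \<inter> V \<subseteq> {\<one>}"
    if N: "subgroup N G" and P: "subgroup P G"
      and vs: "\<And>v s. v \<in> V \<Longrightarrow> s \<in> S \<Longrightarrow> conj_by v s \<in> P"
      and inv: "\<And>p n. p \<in> P \<Longrightarrow> n \<in> N \<Longrightarrow> conj_by p n \<in> N" and NQ: "N \<inter> Q = {}" for N P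
  proof (rule invariant_subset_trivial[OF pair S(2)])
    fix v s c assume v: "v \<in> V" and s: "s \<in> S" and c: "c \<in> N \<inter> V"
    have vc: "v \<in> carrier G" "s \<in> carrier G" "c \<in> carrier G" using v s c SH H V by auto
    have *: "conj_by (conj_by v t) c \<in> V" if t: "t \<in> S'" for t
    proof -
      have tG: "t \<in> carrier G" using t S' by blast
      have iv: "inv v \<in> V" using v V(1) by (simp add: subgroup.m_inv_closed)
      have "conj_by t (conj_by (inv v) c) \<in> H"
        using t S' H(1) iv c p(3) by (intro conj_by_mem_subgroup[OF H(1)]) auto
      moreover have "conj_by t (conj_by (inv v) c) \<notin> carrier G - X"
        using NQ c t iv unfolding Q_def by blast
      ultimately have "conj_by t (conj_by (inv v) c) \<in> V" using X H by blast
      then have "conj_by v (conj_by t (conj_by (inv v) c)) \<in> V" using conj_by_mem_subgroup V(1) v by blast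
      then show ?thesis using vc tG by (simp add: conj_by_conj_by)
    qed
    have "conj_by v (inv s) = inv (conj_by v s)" using vc by (simp add: inv_conj_by)
    then have "conj_by v (inv s) \<in> P" using vs[OF v s] P by (simp add: subgroup.m_inv_closed)
    then show "conj_by (conj_by v s) c \<in> N \<inter> V \<and> conj_by (conj_by v (inv s)) c \<in> N \<inter> V"
      using *[of s] *[of "inv s"] inv vs[OF v s] c s by (auto simp: S'_def)
  qed blast
  ultimately show ?thesis using that by blast
qed

section \<open>Quasi-centralizers\<close>

text \<open>
  The elements that centralize a neighbourhood of \<open>\<one>\<close> in \<open>M\<close>. Intersected with \<open>M\<close> this is the
  quasi-centre of \<open>M\<close>.
\<close>

definition quasi_centralizer :: "'a set \<Rightarrow> 'a set" where
  "quasi_centralizer M =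
     {g \<in> carrier G. \<exists>X. openin T X \<and> \<one> \<in> X \<and> (\<forall>y\<in>X \<inter> M. g \<otimes> y = y \<otimes> g)}"

lemma quasi_centralizerI:
  "g \<in> carrier G \<Longrightarrow> openin T X \<Longrightarrow> \<one> \<in> X \<Longrightarrow> (\<And>y. y \<in> X \<Longrightarrow> y \<in> M \<Longrightarrow> g \<otimes> y = y \<otimes> g) \<Longrightarrow>
    g \<in> quasi_centralizer M"
  unfolding quasi_centralizer_def by blast

lemma quasi_centralizerE:
  assumes "g \<in> quasi_centralizer M"
  obtains X where "openin T X" "\<one> \<in> X" "\<And>y. y \<in> X \<Longrightarrow> y \<in> M \<Longrightarrow> g \<otimes> y = y \<otimes> g" "g \<in> carrier G"
  using assms unfolding quasi_centralizer_def by blast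

lemma subgroup_quasi_centralizer:
  assumes M: "M \<subseteq> carrier G"
  shows "subgroup (quasi_centralizer M) G"
proof (rule subgroupI)
  show "quasi_centralizer M \<subseteq> carrier G" unfolding quasi_centralizer_def by blast
  have "\<one> \<in> quasi_centralizer M"
  proof (rule quasi_centralizerI[of _ "carrier G"])
    show "openin T (carrier G)" using openin_topspace[of T] by (simp add: topspace_eq)
  qed auto
  then show "quasi_centralizer M \<noteq> {}" by blast
  show "inv g \<in> quasi_centralizer M" if "g \<in> quasi_centralizer M" for g
  proof -
    from that obtain X where X: "openin T X" "\<one> \<in> X" "\<And>y. y \<in> X \<Longrightarrow> y \<in> M \<Longrightarrow> g \<otimes> y = y \<otimes> g" "g \<in> carrier G"
      by (rule quasi_centralizerE) blast
    show ?thesis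
    proof (rule quasi_centralizerI[OF _ X(1,2)])
      fix y assume y: "y \<in> X" "y \<in> M"
      then have "g \<in> {x \<in> carrier G. y \<otimes> x = x \<otimes> y}" "y \<in> carrier G" using X M by auto
      then show "inv g \<otimes> y = y \<otimes> inv g"
        using subgroup.m_inv_closed[OF subgroup_centralizer_one[of y], of g] by auto
    qed (use X in simp)
  qed
  show "g \<otimes> h \<in> quasi_centralizer M" if "g \<in> quasi_centralizer M" "h \<in> quasi_centralizer M" for g h
  proof -
    from that(1) obtain X where X: "openin T X" "\<one> \<in> X" "\<And>y. y \<in> X \<Longrightarrow> y \<in> M \<Longrightarrow> g \<otimes> y = y \<otimes> g" "g \<in> carrier G"
      by (rule quasi_centralizerE) blast
    from that(2) obtain Y where Y: "openin T Y" "\<one> \<in> Y" "\<And>y. y \<in> Y \<Longrightarrow> y \<in> M \<Longrightarrow> h \<otimes> y = y \<otimes> h" "h \<in> carrier G"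
      by (rule quasi_centralizerE) blast
    show ?thesis
    proof (rule quasi_centralizerI[of _ "X \<inter> Y"])
      fix y assume y: "y \<in> X \<inter> Y" "y \<in> M"
      then have "g \<in> {x \<in> carrier G. y \<otimes> x = x \<otimes> y}" "h \<in> {x \<in> carrier G. y \<otimes> x = x \<otimes> y}" "y \<in> carrier G"
        using X Y M by auto
      then show "g \<otimes> h \<otimes> y = y \<otimes> (g \<otimes> h)"
        using subgroup.m_closed[OF subgroup_centralizer_one[of y], of g h] by auto
    qed (use X Y in auto)
  qed
qed

lemma conj_by_quasi_centralizer:
  assumes M: "M \<subseteq> carrier G" and P: "subgroup P G"
    and inv: "\<And>p m. p \<in> P \<Longrightarrow> m \<in> M \<Longrightarrow> conj_by p m \<in> M"
    and p: "p \<in> P" and g: "g \<in> quasi_centralizer M"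
  shows "conj_by p g \<in> quasi_centralizer M"
proof -
  have pG: "p \<in> carrier G" using subgroup.mem_carrier[OF P p] .
  from g obtain X where X: "openin T X" "\<one> \<in> X" "\<And>y. y \<in> X \<Longrightarrow> y \<in> M \<Longrightarrow> g \<otimes> y = y \<otimes> g" "g \<in> carrier G"
    by (rule quasi_centralizerE) blast
  let ?Y = "{y \<in> carrier G. conj_by (inv p) y \<in> X}"
  show ?thesis
  proof (rule quasi_centralizerI[of _ ?Y])
    show "openin T ?Y" using pG X by (intro openin_vimage continuous_intros) auto
    fix y assume y: "y \<in> ?Y" "y \<in> M"
    have "conj_by (inv p) y \<in> M" using inv y p P subgroup.m_inv_closed by metis
    then have "g \<otimes> conj_by (inv p) y = conj_by (inv p) y \<otimes> g" using X y by blast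
    then have "conj_by p g \<otimes> conj_by p (conj_by (inv p) y) = conj_by p (conj_by (inv p) y) \<otimes> conj_by p g"
      using pG X y M by (subst conj_by_commute_iff) auto
    then show "conj_by p g \<otimes> y = y \<otimes> conj_by p g" using pG y by simp
  qed (use pG X in auto)
qed

lemma open_subgroup_in_dense:
  assumes "open_subgroup_in M H" "M \<subseteq> cl D" and D: "D \<subseteq> M"
  shows "H \<subseteq> cl (D \<inter> H)"
proof
  fix h assume h: "h \<in> H"
  note H = open_subgroup_inD[OF assms(1)]
  obtain X where X: "openin T X" "H = X \<inter> M" using assms by (auto simp: open_subgroup_in_def)
  show "h \<in> cl (D \<inter> H)" unfolding in_closure_of
  proof (intro conjI allI impI)
    show "h \<in> topspace T" using h H by (auto simp: topspace_eq)
    fix U assume U: "h \<in> U \<and> openin T U"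
    then have "openin T (U \<inter> X)" "h \<in> U \<inter> X" using X h by auto
    moreover have "h \<in> cl D" using h H assms by blast
    ultimately obtain y where "y \<in> D" "y \<in> U \<inter> X"
      by (rule_tac closure_meets_open)
    then show "\<exists>y. y \<in> D \<inter> H \<and> y \<in> U" using X D by blast
  qed
qed

text \<open>
  If the quasi-centre is dense, then \<open>H\<close> is generated by \<open>V\<close> and finitely many quasi-central elements.
  These centralize a common neighbourhood \<open>X\<close> of \<open>\<one>\<close>, and the points of \<open>V\<close> all of whose
  \<open>V\<close>-conjugates remain in \<open>X\<close> form a neighbourhood of \<open>\<one>\<close> contained in the core of \<open>V\<close>.
\<close>

lemma quasi_center_not_dense:
  assumes pair: "expansive_pair M H V" and M: "M \<subseteq> carrier G" "nondiscrete M"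
  shows "\<not> M \<subseteq> cl (quasi_centralizer M \<inter> M)"
proof
  assume dense: "M \<subseteq> cl (quasi_centralizer M \<inter> M)"
  note p = expansive_pairD[OF pair]
  note H = open_subgroup_inD[OF p(1)] and V = open_subgroup_inD[OF p(2)]
  obtain XV where XV: "openin T XV" "V = XV \<inter> M" using p(2) by (auto simp: open_subgroup_in_def)
  let ?D = "quasi_centralizer M \<inter> H"
  have "?D = quasi_centralizer M \<inter> M \<inter> H" using H by blast
  then have "H \<subseteq> cl ?D" using open_subgroup_in_dense[OF p(1) dense Int_lower2] by simp
  then obtain S where S: "finite S" "S \<subseteq> ?D" "generate G (S \<union> V) = H"
    using finite_generation_over_open_subgroup[OF pair, of ?D] by blast
  have "\<forall>s\<in>S. \<exists>X. openin T X \<and> \<one> \<in> X \<and> (\<forall>y\<in>X \<inter> M. s \<otimes> y = y \<otimes> s)"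
    using S unfolding quasi_centralizer_def by blast
  then obtain XS where XS: "\<And>s. s \<in> S \<Longrightarrow> openin T (XS s) \<and> \<one> \<in> XS s \<and> (\<forall>y\<in>XS s \<inter> M. s \<otimes> y = y \<otimes> s)"
    by metis
  define X where "X = \<Inter>(insert (carrier G) (XS ` S))"
  have X: "openin T X" "\<one> \<in> X" unfolding X_def
  proof -
    show "openin T (\<Inter>(insert (carrier G) (XS ` S)))"
    proof (rule openin_Inter)
      show "openin T U" if "U \<in> insert (carrier G) (XS ` S)" for U
        using that XS openin_topspace[of T] by (auto simp: topspace_eq)
    qed (use S in auto)
    show "\<one> \<in> \<Inter>(insert (carrier G) (XS ` S))" using XS by auto
  qed
  have Xc: "s \<otimes> y = y \<otimes> s" if "s \<in> S" "y \<in> X" "y \<in> M" for s y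
    using that XS unfolding X_def by blast
  define B where "B = {w \<in> V. \<exists>v\<in>V. conj_by v w \<in> carrier G - X}"
  have "compactin T B" unfolding B_def
    using p X closedin_topspace[of T]
    by (intro compactin_projection continuous_intros continuous_map_fst continuous_map_snd closedin_diff)
      (auto simp: topspace_eq)
  then have B: "closedin T B" using compactin_imp_closedin Hausdorff by blast
  have "V - B \<subseteq> {\<one>}"
  proof (rule invariant_subset_trivial[OF pair S(3)])
    fix v s c assume v: "v \<in> V" and s: "s \<in> S" and c: "c \<in> V - B"
    have vc: "v \<in> carrier G" "s \<in> carrier G" "c \<in> carrier G" using v s c S H V by auto
    have iv: "inv v \<in> V" using v V(1) by (simp add: subgroup.m_inv_closed)
    let ?c = "conj_by (inv v) c"
    have cG: "?c \<in> carrier G" using vc by simp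
    have "?c \<in> V" using iv c V(1) conj_by_mem_subgroup by blast
    then have "?c \<in> M" using V by blast
    moreover have "?c \<in> X" using c iv cG unfolding B_def by blast
    ultimately have com: "s \<otimes> ?c = ?c \<otimes> s" using Xc s by blast
    then have "s \<in> {x \<in> carrier G. ?c \<otimes> x = x \<otimes> ?c}" using vc by simp
    then have com': "inv s \<otimes> ?c = ?c \<otimes> inv s"
      using subgroup.m_inv_closed[OF subgroup_centralizer_one[OF cG], of s] by simp
    have "conj_by s ?c = ?c" using conj_by_fixed_iff vc cG com by blast
    moreover have "conj_by (inv s) ?c = ?c" using conj_by_fixed_iff vc cG com' by blast
    ultimately show "conj_by (conj_by v s) c \<in> V - B \<and> conj_by (conj_by v (inv s)) c \<in> V - B"
      using vc c by (simp add: conj_by_conj_by)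
  qed blast
  moreover have "(XV - B) \<inter> M \<subseteq> V - B" using XV by blast
  moreover have "\<one> \<in> XV - B"
  proof -
    have "\<one> \<in> XV" using subgroup.one_closed[OF V(1)] XV by blast
    moreover have "conj_by v \<one> = \<one>" if "v \<in> V" for v
      using that V by auto
    then have "\<one> \<notin> B" using X unfolding B_def by auto
    ultimately show ?thesis by blast
  qed
  moreover have "\<one> \<in> M" using subgroup.one_closed[OF V(1)] V by blast
  ultimately have "(XV - B) \<inter> M = {\<one>}" by blast
  moreover have "openin T (XV - B)" using XV B by blast
  ultimately show False using M(2) \<open>\<one> \<in> XV - B\<close> unfolding nondiscrete_def by blast
qed

section \<open>Commuting normal subgroups\<close>

lemma closed_normal_inD:
  assumes "closed_normal_in P N"
  shows "subgroup N G" "N \<subseteq> P" "closedin T N" "N \<subseteq> carrier G" "\<one> \<in> N"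
    "\<And>p n. p \<in> P \<Longrightarrow> n \<in> N \<Longrightarrow> conj_by p n \<in> N"
proof -
  show N: "subgroup N G" using assms by (simp add: closed_normal_in_def)
  show "N \<subseteq> carrier G" by (rule subgroup.subset[OF N])
  show "\<one> \<in> N" by (rule subgroup.one_closed[OF N])
qed (use assms in \<open>simp_all add: closed_normal_in_def\<close>)

lemma closed_normal_in_Int:
  assumes "closed_normal_in P N" "subgroup Q G" "closedin T Q" "Q \<subseteq> P"
  shows "closed_normal_in Q (N \<inter> Q)"
  unfolding closed_normal_in_def
proof (intro conjI ballI)
  note n = closed_normal_inD[OF assms(1)]
  show "subgroup (N \<inter> Q) G" using n(1) assms(2) by (rule subgroups_Inter_pair)
  show "closedin T (N \<inter> Q)" using n(3) assms(3) by blast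
  fix p x assume "p \<in> Q" "x \<in> N \<inter> Q"
  then show "conj_by p x \<in> N \<inter> Q" using n(6)[of p x] conj_by_mem_subgroup[OF assms(2), of p x] assms(4) by blast
qed blast

lemma closed_normal_in_closure:
  assumes P: "subgroup P G" "closedin T P" and E: "subgroup E G" "E \<subseteq> P"
    and inv: "\<And>p x. p \<in> P \<Longrightarrow> x \<in> E \<Longrightarrow> conj_by p x \<in> E"
  shows "closed_normal_in P (cl E)"
  unfolding closed_normal_in_def
proof (intro conjI ballI)
  show "cl E \<subseteq> P" using E P by (simp add: closure_of_minimal)
  fix p n assume "p \<in> P" "n \<in> cl E"
  then show "conj_by p n \<in> cl E" using inv subgroup.mem_carrier[OF P(1), of p]
    by (intro closure_of_image_mem[of "conj_by p"] continuous_intros) auto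
qed (use E subgroup_closure_of in auto)

lemma closed_normal_in_centralizer:
  assumes P: "subgroup P G" "closedin T P" and E: "E \<subseteq> carrier G"
    and inv: "\<And>p e. p \<in> P \<Longrightarrow> e \<in> E \<Longrightarrow> conj_by p e \<in> E"
  shows "closed_normal_in P {x \<in> P. \<forall>e\<in>E. e \<otimes> x = x \<otimes> e}" (is "closed_normal_in P ?Z")
proof -
  have PG: "P \<subseteq> carrier G" using P subgroup.subset by blast
  have eq: "?Z = \<Inter>(insert P ((\<lambda>e. {x \<in> carrier G. e \<otimes> x = x \<otimes> e}) ` E))" using PG by auto
  have "subgroup ?Z G" unfolding eq
  proof (rule subgroups_Inter)
    fix H assume "H \<in> insert P ((\<lambda>e. {x \<in> carrier G. e \<otimes> x = x \<otimes> e}) ` E)"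
    then show "subgroup H G" using P E subgroup_centralizer_one by auto
  qed simp
  moreover have "closedin T ?Z" unfolding eq
  proof (rule closedin_Inter)
    fix H assume "H \<in> insert P ((\<lambda>e. {x \<in> carrier G. e \<otimes> x = x \<otimes> e}) ` E)"
    then show "closedin T H" using P E by (auto intro!: closedin_equalizer continuous_intros)
  qed simp
  moreover have "conj_by p x \<in> ?Z" if p: "p \<in> P" and x: "x \<in> ?Z" for p x
  proof -
    have pG: "p \<in> carrier G" "x \<in> carrier G" using p x PG by auto
    have "e \<otimes> conj_by p x = conj_by p x \<otimes> e" if e: "e \<in> E" for e
    proof -
      let ?e = "conj_by (inv p) e"
      have "?e \<in> E" using inv[OF subgroup.m_inv_closed[OF P(1) p] e] .
      then have "?e \<otimes> x = x \<otimes> ?e" using x by blast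
      then have "conj_by p ?e \<otimes> conj_by p x = conj_by p x \<otimes> conj_by p ?e"
        using pG e E by (subst conj_by_commute_iff) auto
      then show ?thesis using pG e E by (simp add: subset_iff)
    qed
    then show ?thesis using conj_by_mem_subgroup[OF P(1) p] x by auto
  qed
  ultimately show ?thesis unfolding closed_normal_in_def by auto
qed

lemma commutator_mem:
  assumes "subgroup N G" "n \<in> N" "m \<in> carrier G" "conj_by m (inv n) \<in> N"
  shows "conj_by n m \<otimes> inv m \<in> N"
proof -
  have "n \<in> carrier G" using subgroup.mem_carrier[OF assms(1,2)] .
  then show ?thesis using assms by (simp add: commutator_alt subgroup.m_closed)
qed

lemma mutually_normalizing_commute:
  assumes N: "subgroup N G" "n \<in> N" "conj_by m (inv n) \<in> N"
    and M: "subgroup M G" "m \<in> M" "conj_by n m \<in> M" and "N \<inter> M \<subseteq> {\<one>}"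
  shows "n \<otimes> m = m \<otimes> n"
proof -
  have nm: "n \<in> carrier G" "m \<in> carrier G"
    using subgroup.mem_carrier[OF N(1,2)] subgroup.mem_carrier[OF M(1,2)] by auto
  have "conj_by n m \<otimes> inv m \<in> N" using commutator_mem N nm by blast
  moreover have "conj_by n m \<otimes> inv m \<in> M" using M by (simp add: subgroup.m_closed subgroup.m_inv_closed)
  ultimately have "conj_by n m \<otimes> inv m = \<one>" using assms(7) by blast
  then show ?thesis using conj_by_mult_inv_eq_one nm by blast
qed

text \<open>
  For fixed \<open>n \<in> N\<close> the commutator of \<open>n\<close> and \<open>y\<close> lies in \<open>N \<inter> M\<close> and tends to \<open>\<one>\<close> as \<open>y\<close> does, so it
  is \<open>\<one>\<close> as soon as it enters \<open>X\<close>.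
\<close>

lemma locally_trivial_intersection_quasi_centralizes:
  assumes N: "subgroup N G" and M: "subgroup M G"
    and NM: "\<And>n m. n \<in> N \<Longrightarrow> m \<in> M \<Longrightarrow> conj_by n m \<in> M"
    and Y: "openin T Y" "\<one> \<in> Y" "\<And>y n. y \<in> Y \<Longrightarrow> y \<in> M \<Longrightarrow> n \<in> N \<Longrightarrow> conj_by y n \<in> N"
    and X: "openin T X" "\<one> \<in> X" "N \<inter> M \<inter> X \<subseteq> {\<one>}"
  shows "N \<subseteq> quasi_centralizer M"
proof
  fix n assume n: "n \<in> N"
  have nG: "n \<in> carrier G" using subgroup.mem_carrier[OF N n] .
  let ?W = "{y \<in> carrier G. conj_by n y \<otimes> inv y \<in> X}"
  show "n \<in> quasi_centralizer M"
  proof (rule quasi_centralizerI[of _ "?W \<inter> Y"])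
    show "openin T (?W \<inter> Y)" using nG X Y by (intro openin_Int openin_vimage continuous_intros) auto
    fix y assume y: "y \<in> ?W \<inter> Y" "y \<in> M"
    have "inv n \<in> N" using n N by (simp add: subgroup.m_inv_closed)
    then have "conj_by y (inv n) \<in> N" using Y y by blast
    then have "conj_by n y \<otimes> inv y \<in> N" using commutator_mem N n y by blast
    moreover have "conj_by n y \<otimes> inv y \<in> M"
      using NM[OF n y(2)] y M by (simp add: subgroup.m_closed subgroup.m_inv_closed)
    ultimately have "conj_by n y \<otimes> inv y = \<one>" using X(3) y by blast
    then show "n \<otimes> y = y \<otimes> n" using conj_by_mult_inv_eq_one nG y by blast
  qed (use nG X Y in auto)
qed

lemma closed_normal_closure_quasi_center:
  assumes P: "subgroup P G" "closedin T P" and M: "closed_normal_in P M"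
  shows "closed_normal_in P (cl (quasi_centralizer M \<inter> M))"
proof (rule closed_normal_in_closure[OF P])
  note m = closed_normal_inD[OF M]
  show "subgroup (quasi_centralizer M \<inter> M) G"
    using subgroup_quasi_centralizer[OF m(4)] m(1) by (simp add: subgroups_Inter_pair)
  show "quasi_centralizer M \<inter> M \<subseteq> P" using m by blast
  show "conj_by p x \<in> quasi_centralizer M \<inter> M" if "p \<in> P" "x \<in> quasi_centralizer M \<inter> M" for p x
    using conj_by_quasi_centralizer[OF m(4) P(1) m(6)] that m(6) by blast
qed

lemma quasi_center_subset_closure: "M \<subseteq> carrier G \<Longrightarrow> quasi_centralizer M \<inter> M \<subseteq> cl (quasi_centralizer M \<inter> M)"
  by (intro closure_of_subset) (auto simp: topspace_eq)

text \<open>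
  The quasi-centre of the monolith is trivial, because its closure is normal in \<open>P\<close> and is not the whole
  monolith. Hence the quasi-centralizer commutes with the monolith, and the centralizer of the monolith
  is trivial, since otherwise it would contain the monolith and make it abelian.
\<close>

lemma robust_quasi_centralizer_monolith:
  assumes P: "subgroup P G" "closedin T P" and R: "robust P"
    and g: "g \<in> quasi_centralizer (monolith_in P)" "g \<in> P"
  shows "g = \<one>"
proof -
  let ?M = "monolith_in P"
  let ?D = "quasi_centralizer ?M \<inter> ?M"
  have M: "closed_normal_in P ?M" using closed_normal_monolith_in P by blast
  note m = closed_normal_inD[OF M]
  have nd: "nondiscrete ?M" "?M \<noteq> {\<one>}" "simple_in ?M" using R by (auto simp: robust_def)
  obtain H V where pair: "expansive_pair ?M H V" using R by (auto simp: robust_def)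
  have "closed_normal_in P (cl ?D)" using closed_normal_closure_quasi_center[OF P M] .
  then have "cl ?D = {\<one>}"
    using monolith_in_minimal quasi_center_not_dense[OF pair m(4) nd(1)] by blast
  then have D: "?D \<subseteq> {\<one>}" using quasi_center_subset_closure[OF m(4)] by blast
  have L: "subgroup (quasi_centralizer ?M) G" using subgroup_quasi_centralizer[OF m(4)] .
  have "g \<otimes> y = y \<otimes> g" if y: "y \<in> ?M" for y
  proof (rule mutually_normalizing_commute[OF L g(1) _ m(1) y _ D])
    have "inv g \<in> quasi_centralizer ?M" using L g by (simp add: subgroup.m_inv_closed)
    then show "conj_by y (inv g) \<in> quasi_centralizer ?M"
      using conj_by_quasi_centralizer[OF m(4) P(1) m(6)] y m(2) by blast
    show "conj_by g y \<in> ?M" using m(6) g y by blast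
  qed
  then have gZ: "g \<in> {x \<in> P. \<forall>e\<in>?M. e \<otimes> x = x \<otimes> e}" (is "_ \<in> ?Z") using g by auto
  show "g = \<one>"
  proof (rule ccontr)
    assume "g \<noteq> \<one>"
    then have "?Z \<noteq> {\<one>}" using gZ by blast
    moreover have "closed_normal_in P ?Z"
      using closed_normal_in_centralizer[OF P m(4) m(6)] .
    ultimately have "?M \<subseteq> ?Z" using monolith_in_minimal by blast
    then have "x \<in> quasi_centralizer ?M" if "x \<in> ?M" for x
      using that m(4) openin_topspace[of T]
      by (intro quasi_centralizerI[of _ "carrier G"]) (auto simp: topspace_eq)
    then have "?M \<subseteq> {\<one>}" using D by blast
    then show False using nd m by blast
  qed
qed

section \<open>Limits of commuting normal subgroups\<close>

text \<open>
  The centralizer of all conjugates of \<open>a\<close> is a closed normal subgroup containing \<open>b\<close>. If it is all of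
  \<open>M\<close>, then \<open>a\<close> is central.
\<close>

lemma simple_conjugates_commute:
  assumes M: "subgroup M G" "closedin T M" "simple_in M"
    and center: "\<And>z. z \<in> M \<Longrightarrow> (\<And>y. y \<in> M \<Longrightarrow> z \<otimes> y = y \<otimes> z) \<Longrightarrow> z = \<one>"
    and ab: "a \<in> M" "b \<in> M" "\<And>g. g \<in> M \<Longrightarrow> conj_by g a \<otimes> b = b \<otimes> conj_by g a"
  shows "a = \<one> \<or> b = \<one>"
proof (rule ccontr)
  assume neq: "\<not> (a = \<one> \<or> b = \<one>)"
  have MG: "M \<subseteq> carrier G" using M subgroup.subset by blast
  let ?E = "(\<lambda>g. conj_by g a) ` M"
  let ?Z = "{x \<in> M. \<forall>e\<in>?E. e \<otimes> x = x \<otimes> e}"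
  have "closed_normal_in M ?Z"
  proof (rule closed_normal_in_centralizer[OF M(1,2)])
    show "?E \<subseteq> carrier G" using MG ab(1) by (auto simp: subset_iff)
    show "conj_by p e \<in> ?E" if p: "p \<in> M" and e: "e \<in> ?E" for p e
    proof -
      obtain g where g: "g \<in> M" "e = conj_by g a" using e by blast
      have "p \<otimes> g \<in> M" using p g M by (simp add: subgroup.m_closed)
      moreover have "conj_by p e = conj_by (p \<otimes> g) a"
        using p g ab MG by (simp add: conj_by_mult subset_iff)
      ultimately show ?thesis by blast
    qed
  qed
  moreover have "b \<in> ?Z" using ab(2,3) by blast
  ultimately have "?Z = M" using neq M(3) unfolding simple_in_def by blast
  then have Z: "e \<otimes> y = y \<otimes> e" if "e \<in> ?E" "y \<in> M" for e y using that by blast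
  have "conj_by \<one> a \<in> ?E" using subgroup.one_closed[OF M(1)] by blast
  then have "a \<in> ?E" using ab(1) MG by (simp add: subset_iff)
  then have "a = \<one>" using center[OF ab(1)] Z by blast
  then show False using neq by blast
qed

text \<open>
  For each \<open>g\<close> the pairs \<open>(a, b)\<close> satisfying the equation form a closed set, so compactness of
  \<open>Q \<times> Q\<close> applies.
\<close>

lemma limit_of_commuting_pairs:
  assumes Q: "compactin T Q" and D: "D \<subseteq> carrier G"
    and fin: "\<And>F. finite F \<Longrightarrow> F \<subseteq> D \<Longrightarrow>
      \<exists>a\<in>Q. \<exists>b\<in>Q. \<forall>g\<in>F. conj_by g a \<otimes> b = b \<otimes> conj_by g a"
  shows "\<exists>a\<in>Q. \<exists>b\<in>Q. \<forall>g\<in>D. conj_by g a \<otimes> b = b \<otimes> conj_by g a"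
proof -
  let ?T = "prod_topology T T"
  let ?C = "\<lambda>g. {p \<in> topspace ?T. conj_by g (fst p) \<otimes> snd p = snd p \<otimes> conj_by g (fst p)}"
  have QQ: "compactin ?T (Q \<times> Q)" using Q by (simp add: compactin_Times)
  have QT: "Q \<times> Q \<subseteq> topspace ?T" using compactin_subset_topspace[OF QQ] .
  have cl: "closedin ?T (?C g)" if "g \<in> D" for g
    using that D
    by (intro closedin_continuous_maps_eq[OF Hausdorff] continuous_intros continuous_map_fst continuous_map_snd) auto
  have "Q \<times> Q \<inter> \<Inter>(?C ` D) \<noteq> {}"
  proof (rule compactin_fip[THEN iffD1, OF QQ, THEN conjunct2, rule_format], intro conjI ballI allI impI)
    show "closedin ?T C" if "C \<in> ?C ` D" for C using that cl by blast
    fix \<F> assume "finite \<F> \<and> \<F> \<subseteq> ?C ` D"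
    then obtain F where F: "finite F" "F \<subseteq> D" "\<F> = ?C ` F" by (meson finite_subset_image)
    obtain a b where ab: "a \<in> Q" "b \<in> Q" "\<forall>g\<in>F. conj_by g a \<otimes> b = b \<otimes> conj_by g a"
      using fin[OF F(1,2)] by blast
    have "(a, b) \<in> topspace ?T" using ab QT by blast
    then have "(a, b) \<in> Q \<times> Q \<inter> \<Inter>\<F>" using ab F by auto
    then show "Q \<times> Q \<inter> \<Inter>\<F> \<noteq> {}" by blast
  qed
  then obtain p where "p \<in> Q \<times> Q" "\<forall>g\<in>D. p \<in> ?C g" by blast
  then show ?thesis by (cases p) auto
qed

lemma closed_normal_in_Inter:
  assumes "\<F> \<noteq> {}" "\<And>N. N \<in> \<F> \<Longrightarrow> closed_normal_in P N"
  shows "closed_normal_in P (\<Inter>\<F>)"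
proof -
  have "subgroup (\<Inter>\<F>) G" using assms by (intro subgroups_Inter) (auto simp: closed_normal_in_def)
  moreover have "closedin T (\<Inter>\<F>)" using assms by (intro closedin_Inter) (auto simp: closed_normal_in_def)
  moreover have "\<Inter>\<F> \<subseteq> P" using assms closed_normal_inD(2) by blast
  ultimately show ?thesis using assms unfolding closed_normal_in_def by blast
qed

text \<open>
  If any two non-trivial closed normal subgroups met non-trivially, then so would any finite number of
  them, and by compactness of \<open>Q\<close> they would all share a point of \<open>Q\<close>, which would lie in the monolith.
\<close>

lemma non_monolithic_commuting_pair:
  assumes P: "subgroup P G" "closedin T P" "P \<noteq> {\<one>}"
    and Q: "compactin T Q" "\<one> \<notin> Q"
    and meets: "\<And>N. closed_normal_in P N \<Longrightarrow> N \<noteq> {\<one>} \<Longrightarrow> N \<inter> Q \<noteq> {}"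
    and triv: "monolith_in P = {\<one>}"
  shows "\<exists>a\<in>Q. \<exists>b\<in>Q. \<forall>g\<in>P. conj_by g a \<otimes> b = b \<otimes> conj_by g a"
proof -
  let ?\<N> = "{N. closed_normal_in P N \<and> N \<noteq> {\<one>}}"
  have PN: "P \<in> ?\<N>" using P conj_by_mem_subgroup by (auto simp: closed_normal_in_def)
  have "\<exists>A\<in>?\<N>. \<exists>B\<in>?\<N>. A \<inter> B = {\<one>}"
  proof (rule ccontr)
    assume "\<not> ?thesis"
    then have pair: "A \<inter> B \<noteq> {\<one>}" if "A \<in> ?\<N>" "B \<in> ?\<N>" for A B using that by blast
    have Int: "A \<inter> B \<in> ?\<N>" if "A \<in> ?\<N>" "B \<in> ?\<N>" for A B
      using pair[OF that] closed_normal_in_Inter[of "{A, B}" P] that by auto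
    have fin: "\<Inter>\<F> \<in> ?\<N>" if "finite \<F>" "\<F> \<noteq> {}" "\<F> \<subseteq> ?\<N>" for \<F>
      using that
    proof (induction rule: finite_ne_induct)
      case (insert A \<F>)
      then have "A \<inter> \<Inter>\<F> \<in> ?\<N>" using Int[of A "\<Inter>\<F>"] by blast
      then show ?case by simp
    qed auto
    have "Q \<inter> \<Inter>?\<N> \<noteq> {}"
    proof (rule compactin_fip[THEN iffD1, OF Q(1), THEN conjunct2, rule_format], intro conjI ballI allI impI)
      show "closedin T C" if "C \<in> ?\<N>" for C using that closed_normal_inD by blast
      fix \<F> assume \<F>: "finite \<F> \<and> \<F> \<subseteq> ?\<N>"
      then have "\<Inter>(insert P \<F>) \<in> ?\<N>" using PN by (intro fin) auto
      then have "\<Inter>(insert P \<F>) \<inter> Q \<noteq> {}" using meets by blast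
      then show "Q \<inter> \<Inter>\<F> \<noteq> {}" by blast
    qed
    then obtain q where q: "q \<in> Q" "q \<in> \<Inter>?\<N>" by blast
    then have "q \<in> monolith_in P" using PN unfolding monolith_in_def by blast
    then show False using q(1) triv Q(2) by simp
  qed
  then obtain A B where AB: "closed_normal_in P A" "A \<noteq> {\<one>}" "closed_normal_in P B" "B \<noteq> {\<one>}"
      "A \<inter> B = {\<one>}" by blast
  note A = closed_normal_inD[OF AB(1)] and B = closed_normal_inD[OF AB(3)]
  obtain a where a: "a \<in> A" "a \<in> Q" using meets[OF AB(1,2)] by blast
  obtain b where b: "b \<in> B" "b \<in> Q" using meets[OF AB(3,4)] by blast
  have "conj_by g a \<otimes> b = b \<otimes> conj_by g a" if g: "g \<in> P" for g
  proof -
    let ?a = "conj_by g a"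
    have aA: "?a \<in> A" using A(6)[OF g a(1)] .
    have "inv ?a \<in> A" using aA A(1) by (simp add: subgroup.m_inv_closed)
    then have "conj_by b (inv ?a) \<in> A" using A(6)[of b] b(1) B(2) by blast
    moreover have "conj_by ?a b \<in> B" using B(6)[OF _ b(1)] aA A(2) by blast
    ultimately show ?thesis
      using mutually_normalizing_commute[OF A(1) aA _ B(1) b(1)] AB by blast
  qed
  then show ?thesis using a b by blast
qed

text \<open>
  Conjugation by an element normalizing \<open>M\<close> permutes the non-trivial closed normal subgroups of \<open>M\<close>,
  hence preserves their intersection.
\<close>

lemma conj_by_monolith_in_normal:
  assumes M: "subgroup M G" and P: "subgroup P G"
    and inv: "\<And>p m. p \<in> P \<Longrightarrow> m \<in> M \<Longrightarrow> conj_by p m \<in> M"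
    and p: "p \<in> P" and x: "x \<in> monolith_in M"
  shows "conj_by p x \<in> monolith_in M"
proof -
  have pG: "p \<in> carrier G" using subgroup.mem_carrier[OF P p] .
  have ip: "inv p \<in> P" using p P by (simp add: subgroup.m_inv_closed)
  have MG: "M \<subseteq> carrier G" using M subgroup.subset by blast
  have xM: "x \<in> M" "x \<in> carrier G" using x MG monolith_in_subset by auto
  have "conj_by p x \<in> N" if N: "closed_normal_in M N" "N \<noteq> {\<one>}" for N
  proof -
    note n = closed_normal_inD[OF N(1)]
    let ?N = "{y \<in> carrier G. conj_by p y \<in> N}"
    have "closed_normal_in M ?N" unfolding closed_normal_in_def
    proof (intro conjI ballI)
      show "subgroup ?N G" using subgroup_conj_by_preimage n(1) pG by blast
      show "closedin T ?N" using pG n by (intro closedin_vimage continuous_intros) auto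
      show "?N \<subseteq> M"
      proof
        fix y assume y: "y \<in> ?N"
        then have "conj_by (inv p) (conj_by p y) \<in> M" using inv[OF ip] n by blast
        then show "y \<in> M" using y pG by simp
      qed
      fix m y assume m: "m \<in> M" and y: "y \<in> ?N"
      have mG: "m \<in> carrier G" using m MG by blast
      have "conj_by (conj_by p m) (conj_by p y) \<in> N" using n(6) inv[OF p m] y by blast
      moreover have "conj_by (conj_by p m) (conj_by p y) = conj_by p (conj_by m y)"
        using pG mG y by (simp add: conj_by_conj_by)
      ultimately show "conj_by m y \<in> ?N" using mG y by simp
    qed
    moreover have "?N \<noteq> {\<one>}"
    proof -
      obtain z where z: "z \<in> N" "z \<noteq> \<one>" using N n by blast
      then have "conj_by (inv p) z \<in> ?N" "conj_by (inv p) z \<noteq> \<one>" using n pG by (auto simp: subset_iff)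
      then show ?thesis by blast
    qed
    ultimately have "x \<in> ?N" using x unfolding monolith_in_def by blast
    then show ?thesis by blast
  qed
  moreover have "conj_by p x \<in> M" using inv p xM by blast
  ultimately show ?thesis unfolding monolith_in_def by blast
qed

section \<open>Exhaustions by open subgroups\<close>

definition exhaustion :: "'a set set \<Rightarrow> bool" where
  "exhaustion \<O> \<longleftrightarrow> \<O> \<noteq> {} \<and> (\<forall>A\<in>\<O>. subgroup A G \<and> openin T A) \<and>
     (\<forall>A\<in>\<O>. \<forall>B\<in>\<O>. \<exists>C\<in>\<O>. A \<union> B \<subseteq> C) \<and> \<Union>\<O> = carrier G"

lemma exhaustionD:
  assumes "exhaustion \<O>"
  shows "\<O> \<noteq> {}" "\<Union>\<O> = carrier G"
    "\<And>A. A \<in> \<O> \<Longrightarrow> subgroup A G" "\<And>A. A \<in> \<O> \<Longrightarrow> openin T A" "\<And>A. A \<in> \<O> \<Longrightarrow> closedin T A"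
    "\<And>A B. A \<in> \<O> \<Longrightarrow> B \<in> \<O> \<Longrightarrow> \<exists>C\<in>\<O>. A \<union> B \<subseteq> C"
  using assms closedin_open_subgroup by (simp_all add: exhaustion_def)

lemma directed_union_absorbs_finite:
  assumes dir: "\<And>A B. A \<in> \<C> \<Longrightarrow> B \<in> \<C> \<Longrightarrow> \<exists>C\<in>\<C>. A \<union> B \<subseteq> C"
    and F: "finite F" "F \<subseteq> (\<Union>A\<in>\<C>. f A)" and A: "A \<in> \<C>"
    and mono: "\<And>A B. A \<in> \<C> \<Longrightarrow> B \<in> \<C> \<Longrightarrow> A \<subseteq> B \<Longrightarrow> f A \<subseteq> f B"
  shows "\<exists>C\<in>\<C>. A \<subseteq> C \<and> F \<subseteq> f C"
  using F
proof (induction rule: finite_induct)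
  case empty
  then show ?case using A by blast
next
  case (insert x F)
  then obtain C where C: "C \<in> \<C>" "A \<subseteq> C" "F \<subseteq> f C" by blast
  obtain B where B: "B \<in> \<C>" "x \<in> f B" using insert by blast
  obtain E where E: "E \<in> \<C>" "C \<union> B \<subseteq> E" using dir C B by blast
  then have "f C \<subseteq> f E" "f B \<subseteq> f E" using mono C B by auto
  then show ?case using C B E by blast
qed

lemma exhaustion_absorbs_finite:
  assumes "exhaustion \<O>" "finite F" "F \<subseteq> carrier G" "A \<in> \<O>"
  shows "\<exists>C\<in>\<O>. A \<subseteq> C \<and> F \<subseteq> C"
  using directed_union_absorbs_finite[of \<O> F "\<lambda>A. A" A] exhaustionD[OF assms(1)] assms by simp

lemma exhaustion_absorbs_compact:
  assumes ex: "exhaustion \<O>" and K: "compactin T K"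
  shows "\<exists>C\<in>\<O>. K \<subseteq> C"
proof -
  note e = exhaustionD[OF ex]
  have "K \<subseteq> \<Union>\<O>" using compactin_carrier[OF K] e by simp
  then obtain \<F> where F: "finite \<F>" "\<F> \<subseteq> \<O>" "K \<subseteq> \<Union>\<F>" using compactinD[OF K] e by metis
  have "\<exists>C\<in>\<O>. \<Union>\<F> \<subseteq> C" using F(1,2)
  proof (induction rule: finite_induct)
    case empty
    then show ?case using e by auto
  next
    case (insert A \<F>)
    have "A \<in> \<O>" "\<F> \<subseteq> \<O>" using insert.prems by auto
    then obtain C where C: "C \<in> \<O>" "\<Union>\<F> \<subseteq> C" using insert.IH by auto
    then obtain B where "B \<in> \<O>" "A \<union> C \<subseteq> B" using e(6)[OF \<open>A \<in> \<O>\<close> C(1)] by auto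
    then show ?case using C by auto
  qed
  then show ?thesis using F(3) by (meson order_trans)
qed

lemma nondiscreteD: "nondiscrete M \<Longrightarrow> openin T X \<Longrightarrow> \<one> \<in> X \<Longrightarrow> X \<inter> M \<noteq> {\<one>}"
  unfolding nondiscrete_def by blast

lemma nondiscrete_mono:
  assumes "nondiscrete M" "M \<subseteq> N" "\<one> \<in> M"
  shows "nondiscrete N"
  unfolding nondiscrete_def
proof (intro allI impI notI)
  fix X assume X: "openin T X" "\<one> \<in> X" "X \<inter> N = {\<one>}"
  then have "X \<inter> M = {\<one>}" using assms by blast
  then show False using nondiscreteD[OF assms(1) X(1,2)] by blast
qed

text \<open>
  A non-discrete monolith of \<open>B\<close> meets the open subgroup \<open>A\<close> in a non-trivial closed normal subgroup
  of \<open>A\<close>.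
\<close>

lemma monolith_in_mono:
  assumes A: "subgroup A G" "openin T A" and B: "subgroup B G" "closedin T B" "A \<subseteq> B"
    and nd: "nondiscrete (monolith_in B)"
  shows "monolith_in A \<subseteq> monolith_in B"
proof -
  have Acl: "closedin T A" using closedin_open_subgroup A by blast
  have "closed_normal_in A (monolith_in B \<inter> A)"
    using closed_normal_in_Int[OF closed_normal_monolith_in A(1) Acl] B by blast
  moreover have "monolith_in B \<inter> A \<noteq> {\<one>}"
    using nondiscreteD[OF nd A(2)] subgroup.one_closed[OF A(1)] by blast
  ultimately show ?thesis using monolith_in_minimal by blast
qed

text \<open>
  Each \<open>g\<close> lies in all large members of the exhaustion and normalizes their monoliths.
\<close>

lemma directed_union_of_monoliths:
  assumes ex: "exhaustion \<O>" and M: "\<And>A B. A \<in> \<O> \<Longrightarrow> B \<in> \<O> \<Longrightarrow> A \<subseteq> B \<Longrightarrow> monolith_in A \<subseteq> monolith_in B"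
  shows "closed_normal_in (carrier G) (cl (\<Union>A\<in>\<O>. monolith_in A))" (is "closed_normal_in _ (cl ?D)")
proof -
  note e = exhaustionD[OF ex]
  have m: "closed_normal_in A (monolith_in A)" if "A \<in> \<O>" for A
    using that e closed_normal_monolith_in by blast
  note mD = closed_normal_inD[OF m]
  have DG: "?D \<subseteq> carrier G" using mD by blast
  show ?thesis
  proof (rule closed_normal_in_closure)
    show "subgroup (carrier G) G" by (rule subgroup_self)
    show "closedin T (carrier G)" using closedin_topspace[of T] by (simp add: topspace_eq)
    show "subgroup ?D G"
    proof (rule subgroupI)
      obtain A where A: "A \<in> \<O>" using e by blast
      then show "?D \<noteq> {}" using mD(5)[OF A] by blast
      show "inv x \<in> ?D" if "x \<in> ?D" for x
        using that mD(1) subgroup.m_inv_closed by (metis UN_iff)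
      fix x y assume "x \<in> ?D" "y \<in> ?D"
      then obtain A B where AB: "A \<in> \<O>" "B \<in> \<O>" "x \<in> monolith_in A" "y \<in> monolith_in B" by blast
      obtain C where C: "C \<in> \<O>" "A \<union> B \<subseteq> C" using e(6) AB by blast
      then have "x \<in> monolith_in C" "y \<in> monolith_in C" using M[of A C] M[of B C] AB by auto
      then have "x \<otimes> y \<in> monolith_in C" using mD(1)[OF C(1)] by (simp add: subgroup.m_closed)
      then show "x \<otimes> y \<in> ?D" using C by blast
    qed (rule DG)
    fix g x assume g: "g \<in> carrier G" and "x \<in> ?D"
    then obtain A where A: "A \<in> \<O>" "x \<in> monolith_in A" by blast
    obtain C where C: "C \<in> \<O>" "A \<subseteq> C" "{g} \<subseteq> C"
      using exhaustion_absorbs_finite[OF ex, of "{g}" A] g A by blast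
    then have "conj_by g x \<in> monolith_in C" using mD(6)[OF C(1), of g x] M[of A C] A by blast
    then show "conj_by g x \<in> ?D" using C by blast
  qed (rule DG)
qed

lemma generate_Un_generate:
  assumes "K \<subseteq> carrier G" "U \<subseteq> carrier G"
  shows "generate G (K \<union> U) = generate G (generate G K \<union> U)"
proof
  have 1: "generate G K \<union> U \<subseteq> carrier G" using assms generate_incl by blast
  show "generate G (K \<union> U) \<subseteq> generate G (generate G K \<union> U)"
    by (rule mono_generate) (auto intro: generate.incl)
  have "generate G K \<subseteq> generate G (K \<union> U)" by (rule mono_generate) blast
  moreover have "U \<subseteq> generate G (K \<union> U)" by (auto intro: generate.incl)
  ultimately show "generate G (generate G K \<union> U) \<subseteq> generate G (K \<union> U)"
    using generate_subgroup_incl generate_is_subgroup[of "K \<union> U"] assms by simp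
qed

section \<open>Robustness passes to the union\<close>

lemma robust_if_exhausted_by_robust:
  assumes tdlc: "tdlc_group G T" and ex: "exhaustion \<O>" and R: "\<And>A. A \<in> \<O> \<Longrightarrow> robust A"
  shows "robust (carrier G)"
proof -
  note e = exhaustionD[OF ex]
  let ?m = monolith_in
  let ?M = "monolith_in (carrier G)"
  have Gs: "subgroup (carrier G) G" by (rule subgroup_self)
  have Gc: "closedin T (carrier G)" using closedin_topspace[of T] by (simp add: topspace_eq)
  have M: "closed_normal_in (carrier G) ?M" using closed_normal_monolith_in[OF Gs Gc] .
  note MD = closed_normal_inD[OF M]
  have m: "closed_normal_in A (?m A)" if "A \<in> \<O>" for A
    using that e closed_normal_monolith_in by blast
  note mD = closed_normal_inD[OF m]
  have r: "?m A \<noteq> {\<one>}" "nondiscrete (?m A)" "simple_in (?m A)" if "A \<in> \<O>" for A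
    using R[OF that] by (auto simp: robust_def)
  have mono: "?m A \<subseteq> ?m B" if "A \<in> \<O>" "B \<in> \<O>" "A \<subseteq> B" for A B
    using monolith_in_mono[OF e(3,4)[OF that(1)] e(3,5)[OF that(2)] that(3) r(2)[OF that(2)]] .
  \<comment> \<open>A non-trivial closed normal subgroup \<open>N\<close> of \<open>G\<close> meets a large member \<open>C\<close> non-trivially.\<close>
  have below: "?m A \<subseteq> N" if A: "A \<in> \<O>" and N: "closed_normal_in (carrier G) N" "N \<noteq> {\<one>}" for A N
  proof -
    note n = closed_normal_inD[OF N(1)]
    obtain x where x: "x \<in> N" "x \<noteq> \<one>" using N(2) n(5) by blast
    then obtain C where C: "C \<in> \<O>" "A \<subseteq> C" "{x} \<subseteq> C"
      using exhaustion_absorbs_finite[OF ex, of "{x}" A] A n(4) by blast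
    have "closed_normal_in C (N \<inter> C)"
      using closed_normal_in_Int[OF N(1) e(3,5)[OF C(1)] subgroup.subset[OF e(3)[OF C(1)]]] .
    moreover have "N \<inter> C \<noteq> {\<one>}" using x C by blast
    ultimately have "?m C \<subseteq> N" using monolith_in_minimal[of C "N \<inter> C"] by blast
    then show ?thesis using mono[OF A C(1,2)] by blast
  qed
  have mM: "?m A \<subseteq> ?M" if "A \<in> \<O>" for A
    using below[OF that] mD(4)[OF that] unfolding monolith_in_def[of "carrier G"] by blast
  obtain A0 where A0: "A0 \<in> \<O>" using e(1) by blast
  have M1: "?M \<noteq> {\<one>}" using mM[OF A0] r(1)[OF A0] mD(5)[OF A0] by blast
  have Mnd: "nondiscrete ?M" using nondiscrete_mono[OF r(2)[OF A0] mM[OF A0] mD(5)[OF A0]] .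
  let ?D = "\<Union>A\<in>\<O>. ?m A"
  have Dcn: "closed_normal_in (carrier G) (cl ?D)" using directed_union_of_monoliths[OF ex mono] .
  have DG: "?D \<subseteq> carrier G" using mD(4) by (rule UN_least)
  have Dcl: "?D \<subseteq> cl ?D" using DG by (intro closure_of_subset) (simp add: topspace_eq)
  have "cl ?D \<noteq> {\<one>}"
  proof
    assume "cl ?D = {\<one>}"
    then have "?m A0 \<subseteq> {\<one>}" using Dcl A0 by blast
    then show False using r(1)[OF A0] mD(5)[OF A0] by blast
  qed
  then have dense: "?M \<subseteq> cl ?D" using monolith_in_minimal[OF Dcn] by simp
  have simple: "simple_in ?M"
    unfolding simple_in_def
  proof (intro conjI allI impI M1)
    fix N assume N: "closed_normal_in ?M N"
    note n = closed_normal_inD[OF N]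
    show "N = {\<one>} \<or> N = ?M"
    proof (cases "\<exists>A\<in>\<O>. N \<inter> ?m A \<noteq> {\<one>}")
      case True
      then obtain A where A: "A \<in> \<O>" "N \<inter> ?m A \<noteq> {\<one>}" by blast
      have "?m B \<subseteq> N" if B: "B \<in> \<O>" for B
      proof -
        obtain C where C: "C \<in> \<O>" "A \<union> B \<subseteq> C" using e(6)[OF A(1) B] by blast
        have "closed_normal_in (?m C) (N \<inter> ?m C)"
          using closed_normal_in_Int[OF N mD(1,3)[OF C(1)] mM[OF C(1)]] .
        moreover have "N \<inter> ?m C \<noteq> {\<one>}"
          using A(2) mono[OF A(1) C(1)] C(2) n(5) mD(5)[OF A(1)] by blast
        ultimately have "?m C \<subseteq> N" using r(3)[OF C(1)] unfolding simple_in_def by blast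
        then show ?thesis using mono[OF B C(1)] C(2) by blast
      qed
      then have "cl ?D \<subseteq> N" using n(3) by (intro closure_of_minimal UN_least)
      then show ?thesis using dense n(2) by blast
    next
      case False
      have "x = \<one>" if x: "x \<in> N" for x
      proof -
        obtain A where A: "A \<in> \<O>" "x \<in> A" using x n(4) e(2) by blast
        have "x \<in> quasi_centralizer (?m A)"
        proof (rule quasi_centralizerI[of _ "carrier G"])
          show "openin T (carrier G)" using openin_topspace[of T] by (simp add: topspace_eq)
          fix y assume y: "y \<in> ?m A"
          have "inv x \<in> N" using x n(1) by (simp add: subgroup.m_inv_closed)
          then have "conj_by y (inv x) \<in> N" using n(6) y mM[OF A(1)] by blast
          then show "x \<otimes> y = y \<otimes> x"
            using mutually_normalizing_commute[OF n(1) x _ mD(1)[OF A(1)] y mD(6)[OF A(1) A(2) y]] False A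
            by blast
        qed (use x n in auto)
        then show ?thesis
          using robust_quasi_centralizer_monolith[OF e(3,5)[OF A(1)] R[OF A(1)] _ A(2)] by blast
      qed
      then show ?thesis using n(5) by blast
    qed
  qed
  have "\<exists>H V. expansive_pair ?M H V"
  proof -
    let ?L = "?m A0"
    obtain H V where pair: "expansive_pair ?L H V" using R[OF A0] unfolding robust_def by blast
    note p = expansive_pairD[OF pair]
    note H = open_subgroup_inD[OF p(1)] and V = open_subgroup_inD[OF p(2)]
    obtain K where K: "compactin T K" "generate G K = H" using p(5) by blast
    have KG: "K \<subseteq> carrier G" using compactin_carrier[OF K(1)] .
    obtain XH where XH: "openin T XH" "H = XH \<inter> ?L" using p(1) by (auto simp: open_subgroup_in_def)
    obtain XV where XV: "openin T XV" "V = XV \<inter> ?L" using p(2) by (auto simp: open_subgroup_in_def)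
    have 1: "\<one> \<in> XV" "\<one> \<in> XH" using subgroup.one_closed[OF V(1)] subgroup.one_closed[OF H(1)] XV XH by auto
    have "openin T (XV \<inter> A0)" "\<one> \<in> XV \<inter> A0"
      using XV e(4)[OF A0] 1 subgroup.one_closed[OF e(3)[OF A0]] by auto
    then obtain W where W: "subgroup W G" "openin T W" "compactin T W" "W \<subseteq> XV \<inter> A0"
      by (rule tdlc_compact_open_subgroup[OF tdlc])
    define U where "U = W \<inter> ?M"
    have U: "subgroup U G" "U \<subseteq> ?M" "U \<subseteq> A0" "U \<subseteq> XV" "U \<subseteq> carrier G"
      unfolding U_def using W(4) MD(4) subgroups_Inter_pair[OF W(1) MD(1)] by auto
    have Uc: "compactin T U" unfolding U_def
      using closed_Int_compactin[OF MD(3) W(3)] by (simp add: Int_commute)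
    define H' where "H' = generate G (H \<union> U)"
    have HM: "H \<subseteq> ?M" using H mM[OF A0] by blast
    have H': "subgroup H' G" "H' \<subseteq> ?M" "H \<subseteq> H'" "U \<subseteq> H'" unfolding H'_def
      using generate_is_subgroup[of "H \<union> U"] generate_subgroup_incl[OF _ MD(1), of "H \<union> U"] H U HM
      by (auto intro: generate.incl)
    have "expansive_pair ?M H' U" unfolding expansive_pair_def
    proof (intro conjI ballI impI)
      show "open_subgroup_in ?M U" unfolding open_subgroup_in_def U_def[symmetric] using U(1) W(2) U_def by blast
      have "\<exists>Y. openin T Y \<and> H' = Y \<inter> ?M"
        using openin_subgroup_if_neighbourhood[OF MD(1) H'(1,2) W(2)] subgroup.one_closed[OF W(1)] H'(4)
        unfolding U_def by blast
      then show "open_subgroup_in ?M H'" using H' unfolding open_subgroup_in_def by blast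
      have "generate G (K \<union> U) = H'"
        unfolding H'_def using generate_Un_generate[OF KG U(5)] K by simp
      then show "\<exists>K. compactin T K \<and> generate G K = H'" using compactin_Un[OF K(1) Uc] by blast
      show "U \<subseteq> H'" "compactin T U" using H' Uc by auto
      fix x assume x: "x \<in> carrier G" and core: "\<forall>h\<in>H'. conj_by h x \<in> U"
      have "conj_by \<one> x \<in> U" using core subgroup.one_closed[OF H'(1)] by blast
      then have xU: "x \<in> U" using x by simp
      have xA: "x \<in> A0" using xU U by blast
      \<comment> \<open>The commutators \<open>z\<close> of \<open>H\<close> with the core of \<open>U\<close> stay, under conjugation by \<open>H\<close>, in
        \<open>U \<inter> monolith_in A0\<close>, which is contained in \<open>V\<close>. As the core of \<open>V\<close> in \<open>H\<close> is trivial, \<open>z = \<one>\<close>.\<close>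
      have comm: "h \<otimes> x = x \<otimes> h" if h: "h \<in> H" for h
      proof -
        have hG: "h \<in> carrier G" and hL: "h \<in> ?L" using h H by auto
        let ?z = "conj_by h x \<otimes> inv x"
        have "inv h \<in> ?L" using hL mD(1)[OF A0] by (simp add: subgroup.m_inv_closed)
        then have "conj_by x (inv h) \<in> ?L" using mD(6)[OF A0] xA by blast
        then have zL: "?z \<in> ?L" using commutator_mem[OF mD(1)[OF A0] hL x] by blast
        have "?z = \<one>"
        proof (rule expansive_pair_core[OF pair])
          show "?z \<in> carrier G" using hG x by simp
          fix k assume k: "k \<in> H"
          have kG: "k \<in> carrier G" and kL: "k \<in> ?L" using k H by auto
          have "conj_by k ?z \<in> ?L" using conj_by_mem_subgroup[OF mD(1)[OF A0] kL zL] .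
          moreover have "conj_by k ?z = conj_by (k \<otimes> h) x \<otimes> inv (conj_by k x)"
            using kG hG x by (simp add: conj_by_hom conj_by_mult inv_conj_by)
          moreover have "k \<otimes> h \<in> H'" "k \<in> H'" using k h H(1) H'(3) by (auto simp: subgroup.m_closed)
          ultimately have "conj_by k ?z \<in> U"
            using core U(1) by (simp add: subgroup.m_closed subgroup.m_inv_closed)
          then show "conj_by k ?z \<in> V" using U(4) XV \<open>conj_by k ?z \<in> ?L\<close> by blast
        qed
        then show ?thesis using conj_by_mult_inv_eq_one hG x by blast
      qed
      have "x \<in> quasi_centralizer ?L"
        using comm XH 1 by (intro quasi_centralizerI[OF x XH(1)]) auto
      then show "x = \<one>"
        using robust_quasi_centralizer_monolith[OF e(3,5)[OF A0] R[OF A0] _ xA] by blast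
    qed
    then show ?thesis by blast
  qed
  then show ?thesis unfolding robust_def using M1 Mnd simple by blast
qed

section \<open>Robustness passes to large open subgroups\<close>

text \<open>
  The groups \<open>f A\<close> are the members \<open>A\<close> of an exhaustion themselves in the first use and their
  monoliths in the second. If \<open>f B\<close> fails to be monolithic for cofinally many \<open>B\<close>, the commuting
  pairs obtained from these \<open>B\<close> have a limit in \<open>Q \<times> Q\<close> that works for all conjugating elements of
  the union of the \<open>f A\<close>, and by continuity for all of its closure.
\<close>

lemma eventually_monolithic:
  assumes M: "subgroup M G" "closedin T M" "simple_in M"
    and center: "\<And>z. z \<in> M \<Longrightarrow> (\<And>y. y \<in> M \<Longrightarrow> z \<otimes> y = y \<otimes> z) \<Longrightarrow> z = \<one>"
    and Q: "compactin T Q" "Q \<subseteq> M" "\<one> \<notin> Q"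
    and A0: "A0 \<in> \<C>"
    and dir: "\<And>A B. A \<in> \<C> \<Longrightarrow> B \<in> \<C> \<Longrightarrow> \<exists>C\<in>\<C>. A \<union> B \<subseteq> C"
    and f: "\<And>A. A \<in> \<C> \<Longrightarrow> subgroup (f A) G" "\<And>A. A \<in> \<C> \<Longrightarrow> closedin T (f A)"
    and mono: "\<And>A B. A \<in> \<C> \<Longrightarrow> B \<in> \<C> \<Longrightarrow> A \<subseteq> B \<Longrightarrow> f A \<subseteq> f B"
    and nontriv: "f A0 \<noteq> {\<one>}"
    and dense: "M \<subseteq> cl (\<Union>A\<in>\<C>. f A)"
    and meets: "\<And>A N. A \<in> \<C> \<Longrightarrow> A0 \<subseteq> A \<Longrightarrow> closed_normal_in (f A) N \<Longrightarrow> N \<noteq> {\<one>} \<Longrightarrow> N \<inter> Q \<noteq> {}"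
  shows "\<exists>A\<in>\<C>. A0 \<subseteq> A \<and> (\<forall>B\<in>\<C>. A \<subseteq> B \<longrightarrow> monolith_in (f B) \<noteq> {\<one>})"
proof (rule ccontr)
  assume "\<not> ?thesis"
  then have bad: "\<exists>B\<in>\<C>. A \<subseteq> B \<and> monolith_in (f B) = {\<one>}" if "A \<in> \<C>" "A0 \<subseteq> A" for A
    using that by auto
  let ?D = "\<Union>A\<in>\<C>. f A"
  have MG: "M \<subseteq> carrier G" by (rule subgroup.subset[OF M(1)])
  have DG: "?D \<subseteq> carrier G" using subgroup.subset[OF f(1)] by (rule UN_least)
  have "\<exists>a\<in>Q. \<exists>b\<in>Q. \<forall>g\<in>?D. conj_by g a \<otimes> b = b \<otimes> conj_by g a"
  proof (rule limit_of_commuting_pairs[OF Q(1) DG])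
    fix F assume F: "finite F" "F \<subseteq> ?D"
    obtain A where A: "A \<in> \<C>" "A0 \<subseteq> A" "F \<subseteq> f A"
      using directed_union_absorbs_finite[OF dir F A0 mono] by auto
    obtain B where B: "B \<in> \<C>" "A \<subseteq> B" "monolith_in (f B) = {\<one>}" using bad[OF A(1,2)] by auto
    have AB: "A0 \<subseteq> B" using A(2) B(2) by simp
    have "f B \<noteq> {\<one>}"
    proof
      assume "f B = {\<one>}"
      then have "f A0 \<subseteq> {\<one>}" using mono[OF A0 B(1) AB] by simp
      then show False using nontriv subgroup.one_closed[OF f(1)[OF A0]] by blast
    qed
    then obtain a b where ab: "a \<in> Q" "b \<in> Q" "\<forall>g\<in>f B. conj_by g a \<otimes> b = b \<otimes> conj_by g a"
      using non_monolithic_commuting_pair[OF f[OF B(1)] _ Q(1,3) meets[OF B(1) AB] B(3)] by auto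
    then show "\<exists>a\<in>Q. \<exists>b\<in>Q. \<forall>g\<in>F. conj_by g a \<otimes> b = b \<otimes> conj_by g a"
      using A(3) mono[OF A(1) B(1,2)] by blast
  qed
  then obtain a b where ab: "a \<in> Q" "b \<in> Q" "\<And>g. g \<in> ?D \<Longrightarrow> conj_by g a \<otimes> b = b \<otimes> conj_by g a"
    by blast
  have abM: "a \<in> M" "b \<in> M" using ab(1,2) Q(2) by auto
  have abG: "a \<in> carrier G" "b \<in> carrier G" using abM MG by auto
  have "conj_by g a \<otimes> b = b \<otimes> conj_by g a" if g: "g \<in> M" for g
  proof (rule forall_in_closure_of_eq[OF _ Hausdorff _ _ ab(3)])
    show "g \<in> cl ?D" using g dense by blast
    show "continuous_map T T (\<lambda>g. conj_by g a \<otimes> b)" "continuous_map T T (\<lambda>g. b \<otimes> conj_by g a)"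
      using abG by (intro continuous_intros; simp)+
  qed
  then have "a = \<one> \<or> b = \<one>" using simple_conjugates_commute[OF M center abM] by blast
  then show False using ab(1,2) Q(3) by blast
qed

text \<open>
  As \<open>L\<close> need not contain \<open>V\<close>, the pair \<open>(H, V)\<close> cannot be used for \<open>L\<close>. It is replaced by
  \<open>V \<inter> L\<close> and the group generated by \<open>V \<inter> L\<close> and the compact set of all \<open>V\<close>-conjugates of \<open>S\<close>. The core
  of the new pair is invariant under these conjugates, hence trivial by \<open>invariant_subset_trivial\<close>.
\<close>

lemma expansive_pair_in_normalized_subgroup:
  assumes pair: "expansive_pair M H V" and S: "finite S" "generate G (S \<union> V) = H"
    and L: "subgroup L G" "closedin T L" "L \<subseteq> M" "S \<subseteq> L"
    and VL: "\<And>v x. v \<in> V \<Longrightarrow> x \<in> L \<Longrightarrow> conj_by v x \<in> L"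
  shows "\<exists>H V. expansive_pair L H V"
proof -
  note p = expansive_pairD[OF pair]
  note V = open_subgroup_inD[OF p(2)]
  have LG: "L \<subseteq> carrier G" by (rule subgroup.subset[OF L(1)])
  obtain X where X: "openin T X" "V = X \<inter> M" using p(2) by (auto simp: open_subgroup_in_def)
  let ?V = "V \<inter> L"
  let ?E = "\<Union>s\<in>S. (\<lambda>v. conj_by v s) ` V"
  let ?H = "generate G (?E \<union> ?V)"
  have V': "subgroup ?V G" using subgroups_Inter_pair[OF V(1) L(1)] .
  have EL: "?E \<subseteq> L" using VL L(4) by blast
  have H'L: "?E \<union> ?V \<subseteq> L" using EL by blast
  have H': "subgroup ?H G" "?H \<subseteq> L"
    using generate_is_subgroup[of "?E \<union> ?V"] generate_subgroup_incl[OF H'L L(1)] H'L LG by auto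
  have VH: "?V \<subseteq> ?H" "?E \<subseteq> ?H" by (auto intro: generate.incl)
  have E: "compactin T ?E"
  proof (rule compactin_Union)
    show "compactin T B" if "B \<in> (\<lambda>s. (\<lambda>v. conj_by v s) ` V) ` S" for B
      using that L(4) LG by (auto intro!: image_compactin[OF p(4)] continuous_intros)
  qed (use S in simp)
  have Vc: "compactin T ?V" using closed_Int_compactin[OF L(2) p(4)] by (simp add: Int_commute)
  have "expansive_pair L ?H ?V" unfolding expansive_pair_def
  proof (intro conjI ballI impI)
    have XL: "?V = X \<inter> L" using X L(3) by blast
    then show "open_subgroup_in L ?V" unfolding open_subgroup_in_def using V' X(1) by blast
    have "\<one> \<in> X" using subgroup.one_closed[OF V(1)] X by blast
    then show "open_subgroup_in L ?H" unfolding open_subgroup_in_def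
      using openin_subgroup_if_neighbourhood[OF L(1) H' X(1)] XL VH H'(1) by blast
    show "\<exists>K. compactin T K \<and> generate G K = ?H" using compactin_Un[OF E Vc] by blast
    show "?V \<subseteq> ?H" "compactin T ?V" using VH Vc by auto
    fix x assume x: "x \<in> carrier G" and core: "\<forall>h\<in>?H. conj_by h x \<in> ?V"
    let ?C = "{y \<in> carrier G. \<forall>h\<in>?H. conj_by h y \<in> ?V}"
    have inv: "conj_by h y \<in> ?C" if h: "h \<in> ?H" and y: "y \<in> ?C" for h y
    proof -
      have hG: "h \<in> carrier G" using subgroup.mem_carrier[OF H'(1) h] .
      have "conj_by k (conj_by h y) \<in> ?V" if k: "k \<in> ?H" for k
      proof -
        have "k \<otimes> h \<in> ?H" using subgroup.m_closed[OF H'(1) k h] .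
        then have "conj_by (k \<otimes> h) y \<in> ?V" using y by blast
        then show ?thesis using conj_by_mult[of k h y] subgroup.mem_carrier[OF H'(1) k] hG y by simp
      qed
      then show ?thesis using hG y by simp
    qed
    have "?C \<subseteq> {\<one>}"
    proof (rule invariant_subset_trivial[OF pair S(2)])
      show "?C \<subseteq> V"
      proof
        fix y assume y: "y \<in> ?C"
        then have "conj_by \<one> y \<in> ?V" using subgroup.one_closed[OF H'(1)] by blast
        then show "y \<in> V" using y by simp
      qed
      fix v s c assume v: "v \<in> V" and s: "s \<in> S" and c: "c \<in> ?C"
      have vs: "v \<in> carrier G" "s \<in> carrier G" using v s V L(4) LG by auto
      have 1: "conj_by v s \<in> ?H" using v s VH(2) by blast
      have "conj_by v (inv s) = inv (conj_by v s)" using vs by (simp add: inv_conj_by)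
      then have 2: "conj_by v (inv s) \<in> ?H" using subgroup.m_inv_closed[OF H'(1) 1] by simp
      show "conj_by (conj_by v s) c \<in> ?C \<and> conj_by (conj_by v (inv s)) c \<in> ?C"
        using inv[OF 1 c] inv[OF 2 c] by blast
    qed
    moreover have "x \<in> ?C" using x core by blast
    ultimately show "x = \<one>" by blast
  qed
  then show ?thesis by blast
qed

text \<open>
  The conclusion is obtained along the inclusion order of the exhaustion; the members below are made
  larger in turn: \<open>A0\<close> contains \<open>H\<close>, beyond \<open>A1\<close> the members are monolithic, the monolith of \<open>A2\<close>
  contains \<open>S\<close>, and beyond \<open>A3\<close> the monoliths are monolithic themselves.
\<close>

lemma eventually_robust_if_robust:
  assumes ex: "exhaustion \<O>" and R: "robust (carrier G)"
  shows "\<exists>A\<in>\<O>. \<forall>B\<in>\<O>. A \<subseteq> B \<longrightarrow> robust B"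
proof -
  note e = exhaustionD[OF ex]
  let ?m = monolith_in
  let ?M = "monolith_in (carrier G)"
  have Gs: "subgroup (carrier G) G" by (rule subgroup_self)
  have Gc: "closedin T (carrier G)" using closedin_topspace[of T] by (simp add: topspace_eq)
  have Go: "openin T (carrier G)" using openin_topspace[of T] by (simp add: topspace_eq)
  have M: "closed_normal_in (carrier G) ?M" using closed_normal_monolith_in[OF Gs Gc] .
  note MD = closed_normal_inD[OF M]
  have m: "closed_normal_in A (?m A)" if "A \<in> \<O>" for A
    using closed_normal_monolith_in[OF e(3,5)[OF that]] .
  note mD = closed_normal_inD[OF m]
  have M1: "?M \<noteq> {\<one>}" and Mnd: "nondiscrete ?M" and Ms: "simple_in ?M"
    using R by (auto simp: robust_def)
  have qcM: "g = \<one>" if "g \<in> quasi_centralizer ?M" for g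
    using robust_quasi_centralizer_monolith[OF Gs Gc R that] that by (simp add: quasi_centralizer_def)
  have center: "z = \<one>" if z: "z \<in> ?M" "\<And>y. y \<in> ?M \<Longrightarrow> z \<otimes> y = y \<otimes> z" for z
    using z MD(4) by (intro qcM quasi_centralizerI[OF _ Go]) auto
  obtain H V where pair: "expansive_pair ?M H V" using R unfolding robust_def by blast
  note p = expansive_pairD[OF pair]
  note H = open_subgroup_inD[OF p(1)] and V = open_subgroup_inD[OF p(2)]
  obtain XV where XV: "openin T XV" "V = XV \<inter> ?M" using p(2) by (auto simp: open_subgroup_in_def)
  have 1: "\<one> \<in> XV" using subgroup.one_closed[OF V(1)] XV by blast
  obtain K where K: "compactin T K" "generate G K = H" using p(5) by blast
  obtain A0 where A0: "A0 \<in> \<O>" "K \<subseteq> A0" using exhaustion_absorbs_compact[OF ex K(1)] by blast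
  have HA: "H \<subseteq> A" if "A \<in> \<O>" "A0 \<subseteq> A" for A
    using generate_subgroup_incl[of K A] A0(2) that e(3)[OF that(1)] K(2) by auto
  \<comment> \<open>A normal subgroup of a member of the exhaustion that is locally disjoint from the monolith of \<open>G\<close>
    quasi-centralizes it.\<close>
  have trivial_trace: "N \<subseteq> quasi_centralizer ?M"
    if A: "A \<in> \<O>" and N: "closed_normal_in A N" and X: "openin T X" "\<one> \<in> X" "N \<inter> ?M \<inter> X \<subseteq> {\<one>}" for A N X
  proof -
    note n = closed_normal_inD[OF N]
    show ?thesis
      using locally_trivial_intersection_quasi_centralizes[OF n(1) MD(1) _ e(4)[OF A] _ _ X]
        subgroup.one_closed[OF e(3)[OF A]] n(4,6) MD(6) by blast
  qed
  have trivial_trace': "N = {\<one>}"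
    if "A \<in> \<O>" "closed_normal_in A N" "openin T X" "\<one> \<in> X" "N \<inter> ?M \<inter> X \<subseteq> {\<one>}" for A N X
    using trivial_trace[OF that] qcM closed_normal_inD(5)[OF that(2)] by blast
  have mM: "?m A \<subseteq> ?M" if A: "A \<in> \<O>" for A
  proof -
    have "closed_normal_in A (?M \<inter> A)"
      using closed_normal_in_Int[OF M e(3,5)[OF A] subgroup.subset[OF e(3)[OF A]]] .
    moreover have "?M \<inter> A \<noteq> {\<one>}"
      using nondiscreteD[OF Mnd e(4)[OF A] subgroup.one_closed[OF e(3)[OF A]]] by blast
    ultimately have "?m A \<subseteq> ?M \<inter> A" by (rule monolith_in_minimal)
    then show ?thesis by blast
  qed
  have mnd: "nondiscrete (?m A)" if A: "A \<in> \<O>" "?m A \<noteq> {\<one>}" for A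
    unfolding nondiscrete_def
  proof (intro allI impI notI)
    fix X assume X: "openin T X" "\<one> \<in> X" "X \<inter> ?m A = {\<one>}"
    then have "?m A \<inter> ?M \<inter> X \<subseteq> {\<one>}" by blast
    then show False using trivial_trace'[OF A(1) m[OF A(1)] X(1,2)] A(2) by blast
  qed
  have Mdense: "?M \<subseteq> cl (\<Union>A\<in>\<O>. A)"
    using closure_of_subset[of "carrier G" T] MD(4) e(2) by (simp add: topspace_eq)
  have V1: "V \<noteq> {\<one>}" using nondiscreteD[OF Mnd XV(1) 1] XV(2) by simp

  \<comment> \<open>First pass: any finite set of generators over \<open>V\<close> serves to show that large members are
    monolithic.\<close>
  have "H \<subseteq> cl H" using H(3) by (intro closure_of_subset) (simp add: topspace_eq)
  then obtain S1 where S1: "finite S1" "S1 \<subseteq> H" "generate G (S1 \<union> V) = H"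
    using finite_generation_over_open_subgroup[OF pair subset_refl] by auto
  obtain Q1 where Q1: "compactin T Q1" "Q1 \<subseteq> V" "\<one> \<notin> Q1"
    and Q1_detects: "\<And>N P. subgroup N G \<Longrightarrow> subgroup P G \<Longrightarrow>
       (\<And>v s. v \<in> V \<Longrightarrow> s \<in> S1 \<Longrightarrow> conj_by v s \<in> P) \<Longrightarrow>
       (\<And>p n. p \<in> P \<Longrightarrow> n \<in> N \<Longrightarrow> conj_by p n \<in> N) \<Longrightarrow> N \<inter> Q1 = {} \<Longrightarrow> N \<inter> V \<subseteq> {\<one>}"
    using compact_set_detecting_normal_subgroups[OF pair S1(1,3)] by metis
  have Q1_meets: "N \<inter> Q1 \<noteq> {}"
    if A: "A \<in> \<O>" "A0 \<subseteq> A" and N: "closed_normal_in A N" "N \<noteq> {\<one>}" for A N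
  proof
    assume NQ: "N \<inter> Q1 = {}"
    note n = closed_normal_inD[OF N(1)]
    have "conj_by v s \<in> A" if "v \<in> V" "s \<in> S1" for v s
      using conj_by_mem_subgroup[OF e(3)[OF A(1)]] that S1(2) p(3) HA[OF A] by blast
    then have "N \<inter> V \<subseteq> {\<one>}" using Q1_detects[OF n(1) e(3)[OF A(1)] _ n(6) NQ] by blast
    then have "N \<inter> ?M \<inter> XV \<subseteq> {\<one>}" using XV(2) by blast
    then show False using trivial_trace'[OF A(1) N(1) XV(1) 1] N(2) by blast
  qed
  have "A0 \<noteq> {\<one>}" using HA[OF A0(1) subset_refl] p(3) V1 subgroup.one_closed[OF V(1)] by blast
  moreover have "Q1 \<subseteq> ?M" using Q1(2) V(2) by blast
  ultimately have "\<exists>A\<in>\<O>. A0 \<subseteq> A \<and> (\<forall>B\<in>\<O>. A \<subseteq> B \<longrightarrow> ?m B \<noteq> {\<one>})"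
    by (intro eventually_monolithic[where f = "\<lambda>A. A",
          OF MD(1,3) Ms center Q1(1) _ Q1(3) A0(1) e(6,3,5) _ _ Mdense Q1_meets])
  then obtain A1 where A1: "A1 \<in> \<O>" "A0 \<subseteq> A1" and A1m: "\<And>B. B \<in> \<O> \<Longrightarrow> A1 \<subseteq> B \<Longrightarrow> ?m B \<noteq> {\<one>}"
    by auto

  define \<C> where "\<C> = {B \<in> \<O>. A1 \<subseteq> B}"
  have C: "B \<in> \<O>" "A1 \<subseteq> B" "A0 \<subseteq> B" if "B \<in> \<C>" for B
    using that A1 by (auto simp: \<C>_def)
  have C1: "A1 \<in> \<C>" using A1 by (simp add: \<C>_def)
  have mC: "?m B \<noteq> {\<one>}" "nondiscrete (?m B)" if "B \<in> \<C>" for B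
    using A1m[OF C(1,2)[OF that]] mnd[OF C(1)[OF that]] by auto
  have Cdir: "\<exists>C\<in>\<C>. A \<union> B \<subseteq> C" if AB: "A \<in> \<C>" "B \<in> \<C>" for A B
  proof -
    obtain C' where "C' \<in> \<O>" "A \<union> B \<subseteq> C'" using e(6)[OF C(1)[OF AB(1)] C(1)[OF AB(2)]] by blast
    moreover have "A1 \<subseteq> C'" using C(2)[OF AB(1)] calculation by blast
    ultimately show ?thesis by (auto simp: \<C>_def)
  qed
  have mono: "?m A \<subseteq> ?m B" if "A \<in> \<C>" "B \<in> \<C>" "A \<subseteq> B" for A B
    using monolith_in_mono[OF e(3,4)[OF C(1)[OF that(1)]] e(3,5)[OF C(1)[OF that(2)]] that(3) mC(2)[OF that(2)]] .
  have "\<Union>\<C> = carrier G"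
  proof
    show "\<Union>\<C> \<subseteq> carrier G" using e(2) by (auto simp: \<C>_def)
    show "carrier G \<subseteq> \<Union>\<C>"
    proof
      fix g assume "g \<in> carrier G"
      then obtain B where "B \<in> \<O>" "A1 \<subseteq> B" "{g} \<subseteq> B"
        using exhaustion_absorbs_finite[OF ex, of "{g}" A1] A1(1) by auto
      then show "g \<in> \<Union>\<C>" by (auto simp: \<C>_def)
    qed
  qed
  then have exC: "exhaustion \<C>" unfolding exhaustion_def
    using C1 Cdir e(3,4)[OF C(1)] by blast
  let ?D = "\<Union>A\<in>\<C>. ?m A"
  have DM: "?D \<subseteq> ?M" using mM C(1) by blast
  have Dcl: "?D \<subseteq> cl ?D" using DM MD(4) by (intro closure_of_subset) (auto simp: topspace_eq)
  have "cl ?D \<noteq> {\<one>}"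
  proof
    assume "cl ?D = {\<one>}"
    then have "?m A1 \<subseteq> {\<one>}" using Dcl C1 by blast
    then show False using mC(1)[OF C1] mD(5)[OF A1(1)] by blast
  qed
  then have dense: "?M \<subseteq> cl ?D"
    using monolith_in_minimal[OF directed_union_of_monoliths[OF exC mono]] by simp

  \<comment> \<open>Second pass: the generators are now taken from the union of the monoliths, so that a single
    monolith contains them all.\<close>
  have "?D \<inter> H \<subseteq> H" "H \<subseteq> cl (?D \<inter> H)" using open_subgroup_in_dense[OF p(1) dense DM] by auto
  then obtain S where S: "finite S" "S \<subseteq> ?D \<inter> H" "generate G (S \<union> V) = H"
    by (rule finite_generation_over_open_subgroup[OF pair])
  have SD: "S \<subseteq> ?D" using S(2) by blast
  obtain A2 where A2: "A2 \<in> \<C>" "S \<subseteq> ?m A2"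
    using directed_union_absorbs_finite[OF Cdir S(1) SD C1 mono] by auto
  have Sm: "S \<subseteq> ?m B" if "B \<in> \<C>" "A2 \<subseteq> B" for B using A2 mono[OF A2(1) that] by blast
  have Vm: "conj_by v x \<in> ?m B" if "B \<in> \<C>" "v \<in> V" "x \<in> ?m B" for B v x
    using mD(6)[OF C(1)[OF that(1)] _ that(3)] HA[OF C(1,3)[OF that(1)]] p(3) that(2) by blast
  have mpair: "\<exists>H V. expansive_pair (?m B) H V" if B: "B \<in> \<C>" "A2 \<subseteq> B" for B
    using expansive_pair_in_normalized_subgroup[OF pair S(1,3) mD(1,3)[OF C(1)[OF B(1)]] mM[OF C(1)[OF B(1)]]
        Sm[OF B] Vm[OF B(1)]] .
  obtain Q where Q: "compactin T Q" "Q \<subseteq> V" "\<one> \<notin> Q"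
    and Q_detects: "\<And>N P. subgroup N G \<Longrightarrow> subgroup P G \<Longrightarrow>
       (\<And>v s. v \<in> V \<Longrightarrow> s \<in> S \<Longrightarrow> conj_by v s \<in> P) \<Longrightarrow>
       (\<And>p n. p \<in> P \<Longrightarrow> n \<in> N \<Longrightarrow> conj_by p n \<in> N) \<Longrightarrow> N \<inter> Q = {} \<Longrightarrow> N \<inter> V \<subseteq> {\<one>}"
    using compact_set_detecting_normal_subgroups[OF pair S(1,3)] by metis
  have Q_meets: "N \<inter> Q \<noteq> {}"
    if B: "B \<in> \<C>" "A2 \<subseteq> B" and N: "closed_normal_in (?m B) N" "N \<noteq> {\<one>}" for B N
  proof
    assume NQ: "N \<inter> Q = {}"
    note n = closed_normal_inD[OF N(1)]
    note BO = C(1)[OF B(1)]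
    let ?L = "?m B"
    have "conj_by v s \<in> ?L" if "v \<in> V" "s \<in> S" for v s
      using Vm[OF B(1) that(1)] Sm[OF B] that(2) by blast
    then have "N \<inter> V \<subseteq> {\<one>}" using Q_detects[OF n(1) mD(1)[OF BO] _ n(6) NQ] by blast
    then have X: "N \<inter> ?L \<inter> XV \<subseteq> {\<one>}" using XV(2) mM[OF BO] by blast
    have "conj_by x y \<in> ?L" if "x \<in> N" "y \<in> ?L" for x y
      using conj_by_mem_subgroup[OF mD(1)[OF BO] _ that(2)] that(1) n(2) by blast
    then have "N \<subseteq> quasi_centralizer ?L"
      using locally_trivial_intersection_quasi_centralizes[OF n(1) mD(1)[OF BO] _ Go one_closed n(6) XV(1) 1 X]
      by blast
    then have "N \<subseteq> cl (quasi_centralizer ?L \<inter> ?L)"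
      using quasi_center_subset_closure[OF mD(4)[OF BO]] n(2) by blast
    then have "cl (quasi_centralizer ?L \<inter> ?L) \<noteq> {\<one>}" using N(2) n(5) by blast
    then have "?L \<subseteq> cl (quasi_centralizer ?L \<inter> ?L)"
      using monolith_in_minimal[OF closed_normal_closure_quasi_center[OF e(3,5)[OF BO] m[OF BO]]] by simp
    moreover obtain H' V' where "expansive_pair ?L H' V'" using mpair[OF B] by blast
    ultimately show False using quasi_center_not_dense[OF _ mD(4)[OF BO] mC(2)[OF B(1)]] by blast
  qed
  have QM: "Q \<subseteq> ?M" using Q(2) V(2) by blast
  have "\<exists>A\<in>\<C>. A2 \<subseteq> A \<and> (\<forall>B\<in>\<C>. A \<subseteq> B \<longrightarrow> ?m (?m B) \<noteq> {\<one>})"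
    by (intro eventually_monolithic[where f = ?m, OF MD(1,3) Ms center Q(1) QM Q(3) A2(1) Cdir
          mD(1)[OF C(1)] mD(3)[OF C(1)] mono mC(1)[OF A2(1)] dense Q_meets])
  then obtain A3 where A3: "A3 \<in> \<C>" "A2 \<subseteq> A3" and A3m: "\<And>B. B \<in> \<C> \<Longrightarrow> A3 \<subseteq> B \<Longrightarrow> ?m (?m B) \<noteq> {\<one>}"
    by auto

  have "robust B" if BO: "B \<in> \<O>" and AB: "A3 \<subseteq> B" for B
  proof -
    have B: "B \<in> \<C>" using C(2)[OF A3(1)] BO AB by (auto simp: \<C>_def)
    let ?L = "?m B"
    have LL: "closed_normal_in ?L (?m ?L)" using closed_normal_monolith_in[OF mD(1,3)[OF BO]] .
    note ll = closed_normal_inD[OF LL]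
    have "closed_normal_in B (?m ?L)"
      unfolding closed_normal_in_def
      using ll(1-3) mD(2)[OF BO] conj_by_monolith_in_normal[OF mD(1)[OF BO] e(3)[OF BO] mD(6)[OF BO]]
      by blast
    then have "?L \<subseteq> ?m ?L" by (rule monolith_in_minimal) (rule A3m[OF B AB])
    then have "N = ?L" if "closed_normal_in ?L N" "N \<noteq> {\<one>}" for N
      using monolith_in_minimal[OF that] closed_normal_inD(2)[OF that(1)] by blast
    then have "simple_in ?L" using mC(1)[OF B] unfolding simple_in_def by blast
    moreover have "A2 \<subseteq> B" using A3(2) AB by blast
    ultimately show ?thesis unfolding robust_def using mC[OF B] mpair[OF B] by blast
  qed
  then show ?thesis using C(1)[OF A3(1)] by blast
qed

end

section \<open>The equivalence along the directed system\<close>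

theorem theorem1p1p3:
  fixes G :: "('a, 'b) monoid_scheme" and T :: "'a topology"
    and I :: "'i set" and r :: "('i \<times> 'i) set" and Os :: "'i \<Rightarrow> 'a set"
  assumes "tdlc_group G T"
    and "directed_set I r"
    and "\<And>i. i \<in> I \<Longrightarrow> open_subgroup (Os i) G T"
    and "\<And>i. i \<in> I \<Longrightarrow> compactly_generated (G\<lparr>carrier := Os i\<rparr>) (subtopology T (Os i))"
    and "\<And>i j. i \<in> I \<Longrightarrow> j \<in> I \<Longrightarrow> (i, j) \<in> r \<Longrightarrow> Os i \<subseteq> Os j"
    and "(\<Union>i\<in>I. Os i) = carrier G"
  shows "robustly_monolithic G T \<longleftrightarrow>
    (\<exists>i\<in>I. \<forall>j\<in>I. (i, j) \<in> r \<longrightarrow>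
       robustly_monolithic (G\<lparr>carrier := Os j\<rparr>) (subtopology T (Os j)))"
proof -
  note tdlc = assms(1) and dir = assms(2) and Os = assms(3) and mono = assms(5) and union = assms(6)
  interpret topological_group G T using tdlc by (simp add: tdlc_group_def)
  have refl: "(i, i) \<in> r" if "i \<in> I" for i
    using that dir by (auto simp: directed_set_def preorder_on_def refl_on_def)
  have trans: "(i, k) \<in> r" if "(i, j) \<in> r" "(j, k) \<in> r" for i j k
    using dir that unfolding directed_set_def preorder_on_def trans_def by blast
  have upper: "\<exists>k\<in>I. (i, k) \<in> r \<and> (j, k) \<in> r" if "i \<in> I" "j \<in> I" for i j
    using that dir by (simp add: directed_set_def)
  have sub: "subgroup (Os i) G" "openin T (Os i)" if "i \<in> I" for i
    using Os[OF that] by (auto simp: open_subgroup_def)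
  have R: "robustly_monolithic (G\<lparr>carrier := Os i\<rparr>) (subtopology T (Os i)) \<longleftrightarrow> robust (Os i)"
    if "i \<in> I" for i
    using robustly_monolithic_iff[OF tdlc sub(1)[OF that] closedin_open_subgroup[OF sub[OF that]]] .
  have RG: "robustly_monolithic G T \<longleftrightarrow> robust (carrier G)"
    using robustly_monolithic_iff[OF tdlc subgroup_self] closedin_topspace[of T] subtopology_topspace[of T]
    by (simp add: topspace_eq)
  \<comment> \<open>The exhaustion lemmas speak about inclusion, and inclusion of \<open>Os i\<close> in \<open>Os j\<close> need not come from
    \<open>(i, j) \<in> r\<close>. Only the converse is used, after restricting to the indices above a given one.\<close>
  have tail: "exhaustion (Os ` {j \<in> I. (i, j) \<in> r})" if i: "i \<in> I" for i
  proof -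
    let ?J = "{j \<in> I. (i, j) \<in> r}"
    have "\<exists>C\<in>Os ` ?J. Os j \<union> Os k \<subseteq> C" if jk: "j \<in> ?J" "k \<in> ?J" for j k
    proof -
      obtain l where l: "l \<in> I" "(j, l) \<in> r" "(k, l) \<in> r" using upper jk by blast
      then have "l \<in> ?J" using trans jk by blast
      moreover have "Os j \<union> Os k \<subseteq> Os l" using mono l jk by blast
      ultimately show ?thesis by blast
    qed
    moreover have "\<Union>(Os ` ?J) = carrier G"
    proof
      show "\<Union>(Os ` ?J) \<subseteq> carrier G" using union by blast
      show "carrier G \<subseteq> \<Union>(Os ` ?J)"
      proof
        fix g assume "g \<in> carrier G"
        then obtain j where j: "j \<in> I" "g \<in> Os j" using union by blast
        obtain k where k: "k \<in> I" "(i, k) \<in> r" "(j, k) \<in> r" using upper[OF i j(1)] by blast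
        then show "g \<in> \<Union>(Os ` ?J)" using mono[OF j(1) k(1,3)] j(2) by blast
      qed
    qed
    ultimately show ?thesis unfolding exhaustion_def using i refl sub by auto
  qed
  show ?thesis unfolding RG
  proof
    assume "robust (carrier G)"
    obtain i0 where i0: "i0 \<in> I" using dir by (auto simp: directed_set_def)
    obtain A where A: "A \<in> Os ` {j \<in> I. (i0, j) \<in> r}"
      "\<forall>B\<in>Os ` {j \<in> I. (i0, j) \<in> r}. A \<subseteq> B \<longrightarrow> robust B"
      using eventually_robust_if_robust[OF tail[OF i0] \<open>robust (carrier G)\<close>] by blast
    then obtain i where i: "i \<in> I" "(i0, i) \<in> r" "A = Os i" by blast
    have "robust (Os j)" if "j \<in> I" "(i, j) \<in> r" for j
      using A(2) mono[OF i(1) that] trans[OF i(2) that(2)] that(1) i(3) by blast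
    then show "\<exists>i\<in>I. \<forall>j\<in>I. (i, j) \<in> r \<longrightarrow>
        robustly_monolithic (G\<lparr>carrier := Os j\<rparr>) (subtopology T (Os j))" using R i(1) by blast
  next
    assume "\<exists>i\<in>I. \<forall>j\<in>I. (i, j) \<in> r \<longrightarrow>
        robustly_monolithic (G\<lparr>carrier := Os j\<rparr>) (subtopology T (Os j))"
    then obtain i where i: "i \<in> I" "\<And>j. j \<in> I \<Longrightarrow> (i, j) \<in> r \<Longrightarrow> robust (Os j)" using R by blast
    then show "robust (carrier G)"
      using robust_if_exhausted_by_robust[OF tdlc tail[OF i(1)]] by blast
  qed
qed

end
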